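(* Let $k>2$ be an integer and $0\leqslant\beta<1$. If a sequence $(x_n)_{n\in\mathbb N}\subseteq[0,1]$ has Poissonian $(k,\beta)$--correlations, then it also has Poissonian $(k-1,\beta)$--correlations. In particular, Poissonian $(k,\beta)$--correlations imply $\alpha$--PPC for every $0\leqslant\alpha\leqslant\beta$, and therefore uniform distribution mod $1$.
   Context: For $x\in\mathbb R$, $\|x\|$ is the distance to the nearest integer and $(\!(x)\!)$ is the unique $y\in(-\frac12,\frac12]$ with $x-y\in\mathbb Z$. For $m\geqslant2$, $0\leqslant\beta\leqslant1$, $N\geqslant1$ and a closed rectangle $\mathcal R=[a_1,b_1]\times\cdots\times[a_{m-1},b_{m-1}]\subseteq\mathbb R^{m-1}$, $R_m(\beta;\mathcal R,N)=\frac{1}{N^{m-(m-1)\beta}}\#\{(i_1,\dots,i_m)\in\{1,\dots,N\}^m\text{ pairwise distinct}: N^{\beta}((\!(x_{i_1}-x_{i_2})\!),\dots,(\!(x_{i_1}-x_{i_m})\!))\in\mathcal R\}$. For $0<\beta\leqslant1$, the sequence has Poissonian $(m,\beta)$--correlations if $\lim_{N\to\infty}R_m(\beta;\mathcal R,N)=\lambda(\mathcal R)$ for all such rectangles ($\lambda$ = $(m-1)$-dimensional Lebesgue measure); for $\beta=0$ this is required only for rectangles $\mathcal R\subseteq[-\frac12,\frac12]^{m-1}$. For $0\leqslant\alpha\leqslant1$, $R_2(\alpha;s,N)=\frac{1}{N^{2-\alpha}}\#\{(m,n):m,n\leqslant N,\ m\neq n,\ \|x_m-x_n\|\leqslant s/N^{\alpha}\}$;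 $\alpha$--PPC means $\lim_NR_2(\alpha;s,N)=2s$ for all $s>0$ when $\alpha>0$, and for all $0<s\leqslant\frac12$ when $\alpha=0$. Uniform distribution mod $1$: $\frac1N\#\{i\leqslant N:x_i\in[a,b]\}\to b-a$ for all $0\leqslant a<b\leqslant1$. *)

theory Defs
  imports "HOL-Analysis.Analysis"
begin

text \<open>
  Sequences are functions on the naturals of which only the values at indices \<open>n \<ge> 1\<close> are used.
  Since the order of correlation varies, tuples \<open>(i\<^sub>1, \<dots>, i\<^sub>m)\<close> and points of
  \<open>(m-1)\<close>-dimensional space are extensional functions on \<open>{1..m}\<close> and \<open>{1..m-1}\<close>, respectively.
\<close>

definition dist_int :: "real \<Rightarrow> real" where
  "dist_int t = infdist t \<int>"

definition signed_res :: "real \<Rightarrow> real" where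
  "signed_res t = (THE y. y \<in> {-(1/2)<..1/2} \<and> t - y \<in> \<int>)"

lemma signed_res_ex1: "\<exists>!y::real. y \<in> {-(1/2)<..1/2} \<and> t - y \<in> \<int>"
proof (rule ex1I)
  let ?y = "t - of_int \<lceil>t - 1/2\<rceil>"
  show "?y \<in> {-(1/2)<..1/2} \<and> t - ?y \<in> \<int>"
    by (simp, linarith)
next
  fix y :: real
  assume *: "y \<in> {-(1/2)<..1/2} \<and> t - y \<in> \<int>"
  then obtain n where n: "t - y = of_int n" by (auto elim: Ints_cases)
  with * have "\<lceil>t - 1/2\<rceil> = n" by (intro ceiling_unique) auto
  with n show "y = t - of_int \<lceil>t - 1/2\<rceil>" by simp
qed

definition rectangle :: "nat \<Rightarrow> (nat \<Rightarrow> real) \<Rightarrow> (nat \<Rightarrow> real) \<Rightarrow> (nat \<Rightarrow> real) set" where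
  "rectangle d a b = (\<Pi>\<^sub>E j\<in>{1..d}. {a j..b j})"

abbreviation lebesgue_space :: "nat \<Rightarrow> (nat \<Rightarrow> real) measure" where
  "lebesgue_space d \<equiv> (\<Pi>\<^sub>M j\<in>{1..d}. lborel)"

lemma measure_rectangle:
  assumes "\<And>j. j \<in> {1..d} \<Longrightarrow> a j \<le> b j"
  shows "measure (lebesgue_space d) (rectangle d a b) = (\<Prod>j\<in>{1..d}. b j - a j)"
proof -
  interpret product_sigma_finite "\<lambda>_::nat. lborel :: real measure" ..
  have "emeasure (lebesgue_space d) (rectangle d a b) = (\<Prod>j\<in>{1..d}. ennreal (b j - a j))"
    unfolding rectangle_def using assms by (subst emeasure_PiM) (auto intro!: prod.cong)
  also have "\<dots> = ennreal (\<Prod>j\<in>{1..d}. b j - a j)"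
    using assms by (intro prod_ennreal) (auto simp: field_simps)
  finally show ?thesis
    using assms by (auto simp: measure_def intro!: enn2real_ennreal prod_nonneg)
qed

definition corr :: "nat \<Rightarrow> real \<Rightarrow> (nat \<Rightarrow> real) \<Rightarrow> (nat \<Rightarrow> real) set \<Rightarrow> nat \<Rightarrow> real" where
  "corr m \<beta> x \<R> N =
     real (card {i \<in> {1..m} \<rightarrow>\<^sub>E {1..N}. inj_on i {1..m} \<and>
       (\<lambda>j\<in>{1..m-1}. real N powr \<beta> * signed_res (x (i 1) - x (i (j + 1)))) \<in> \<R>})
     / real N powr (real m - (real m - 1) * \<beta>)"

definition poissonian_correlations :: "nat \<Rightarrow> real \<Rightarrow> (nat \<Rightarrow> real) \<Rightarrow> bool" where
  "poissonian_correlations m \<beta> x \<longleftrightarrow>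
     (\<forall>a b. (\<forall>j\<in>{1..m-1}. a j \<le> b j) \<longrightarrow>
        (\<beta> = 0 \<longrightarrow> rectangle (m-1) a b \<subseteq> rectangle (m-1) (\<lambda>_. -(1/2)) (\<lambda>_. 1/2)) \<longrightarrow>
        (\<lambda>N. corr m \<beta> x (rectangle (m-1) a b) N)
          \<longlonglongrightarrow> measure (lebesgue_space (m-1)) (rectangle (m-1) a b))"

definition pair_corr :: "real \<Rightarrow> (nat \<Rightarrow> real) \<Rightarrow> real \<Rightarrow> nat \<Rightarrow> real" where
  "pair_corr \<alpha> x s N =
     real (card {(m, n). m \<in> {1..N} \<and> n \<in> {1..N} \<and> m \<noteq> n \<and>
       dist_int (x m - x n) \<le> s / real N powr \<alpha>})
     / real N powr (2 - \<alpha>)"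

definition PPC :: "real \<Rightarrow> (nat \<Rightarrow> real) \<Rightarrow> bool" where
  "PPC \<alpha> x \<longleftrightarrow>
     (\<forall>s>0. (\<alpha> = 0 \<longrightarrow> s \<le> 1/2) \<longrightarrow> (\<lambda>N. pair_corr \<alpha> x s N) \<longlonglongrightarrow> 2 * s)"

definition uniformly_distributed :: "(nat \<Rightarrow> real) \<Rightarrow> bool" where
  "uniformly_distributed x \<longleftrightarrow>
     (\<forall>a b. 0 \<le> a \<longrightarrow> a < b \<longrightarrow> b \<le> 1 \<longrightarrow>
        (\<lambda>N. real (card {i \<in> {1..N}. x i \<in> {a..b}}) / real N) \<longlonglongrightarrow> b - a)"

end

theory Submission
  imports Defs
begin

text \<open>
  Put \<open>p = k - 1\<close> and let \<open>G\<close> be the number of points \<open>x\<^sub>j\<close>, \<open>j \<noteq> i\<close>, within \<open>s / N\<^sup>\<beta>\<close> of \<open>x\<^sub>i\<close>, divided by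
  \<open>N\<^bsup>1-\<beta>\<^esup>\<close>, where \<open>i \<le> N\<close> is random. Since \<open>\<beta> < 1\<close>, the requirement that indices be distinct is
  negligible, and the correlations of order \<open>k\<close> for a cube say that \<open>E G\<^sup>p \<rightarrow> (2s)\<^sup>p\<close>. By Jensen the pair
  correlations are asymptotically at most \<open>2s\<close>, for every \<open>s\<close>. Counting points in sliding windows
  on the circle, Cauchy--Schwarz bounds a Cesaro mean of pair correlations over scales up to \<open>s\<close> from
  below by the matching constant, so all these upper bounds are attained and \<open>E G \<rightarrow> 2s\<close>. This is the
  equality case of Jensen, so \<open>G \<rightarrow> 2s\<close> in \<open>L\<^sup>p\<close>; hence the last coordinate, confined to an interval of
  length \<open>1\<close>, can be summed out of the correlations of order \<open>k\<close>.

  The second moment of the window counts also bounds the pair correlations at every coarser scale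
  from above (by AM-GM), and the same Cauchy--Schwarz argument then gives their limits. At scale
  \<open>\<alpha> = 0\<close> it shows that the window counts are nearly constant in \<open>L\<^sup>2\<close>, which is uniform distribution.
\<close>

subsection \<open>Counting points in sliding windows on the circle\<close>

lemma signed_res_bounds: "- (1/2) < signed_res t" "signed_res t \<le> 1/2"
  and signed_res_Ints: "t - signed_res t \<in> \<int>"
  using theI'[OF signed_res_ex1[of t]] unfolding signed_res_def by auto

lemma dist_int_le: "dist_int t \<le> \<bar>t - of_int n\<bar>"
  unfolding dist_int_def dist_real_def[symmetric] by (rule infdist_le) simp

lemma dist_int_eq_abs_signed_res: "dist_int t = \<bar>signed_res t\<bar>"
proof (rule antisym)
  obtain n where n: "t - signed_res t = of_int n"
    using signed_res_Ints by (auto elim: Ints_cases)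
  then show "dist_int t \<le> \<bar>signed_res t\<bar>"
    using dist_int_le[of t n] by (simp add: algebra_simps)
  show "\<bar>signed_res t\<bar> \<le> dist_int t"
    unfolding dist_int_def infdist_def
  proof (subst if_not_P, use Ints_0 in blast, rule cINF_greatest)
    fix z :: real assume "z \<in> \<int>"
    then obtain m where m: "z = of_int m" by (auto elim: Ints_cases)
    have eq: "t - z = signed_res t + of_int (n - m)" using n m by simp
    show "\<bar>signed_res t\<bar> \<le> dist t z"
    proof (cases "n = m")
      case True then show ?thesis using eq by (simp add: dist_real_def)
    next
      case False
      then have "\<bar>real_of_int (n - m)\<bar> \<ge> 1" by linarith
      then show ?thesis using eq signed_res_bounds[of t] unfolding dist_real_def by linarith
    qed
  qed (use Ints_0 in blast)
qed

lemma dist_int_attained: obtains n where "dist_int t = \<bar>t - of_int n\<bar>"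
proof -
  obtain n where "t - signed_res t = of_int n"
    using signed_res_Ints by (auto elim: Ints_cases)
  then have "dist_int t = \<bar>t - of_int n\<bar>"
    by (simp add: dist_int_eq_abs_signed_res algebra_simps)
  then show ?thesis by (rule that)
qed

section \<open>Pair counts, window counts and their second moments\<close>

lemma card_filter_eq_sum:
  assumes "finite A"
  shows "real (card {i \<in> A. P i}) = (\<Sum>i\<in>A. of_bool (P i))"
  using assms by (simp add: Collect_conj_eq of_bool_def sum.If_cases)

text \<open>The diagonal pairs are kept, unlike in \<open>pair_corr\<close>, because squaring a
  window count produces them too.\<close>

definition near_pairs :: "(nat \<Rightarrow> real) \<Rightarrow> real \<Rightarrow> nat \<Rightarrow> nat" where
  "near_pairs x r N = card {(m, n). m \<in> {1..N} \<and> n \<in> {1..N} \<and> dist_int (x m - x n) \<le> r}"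

text \<open>
  The circle is cut into \<open>M\<close> boxes of length \<open>1 / M\<close>; the window at \<open>c\<close> is the union of the \<open>L\<close>
  cyclically consecutive boxes starting with number \<open>c\<close>.
\<close>

definition window :: "nat \<Rightarrow> nat \<Rightarrow> (nat \<Rightarrow> real) \<Rightarrow> nat \<Rightarrow> int \<Rightarrow> nat" where
  "window M L x N c = card {i \<in> {1..N}. (\<lfloor>real M * x i\<rfloor> - c) mod int M < int L}"

lemma near_pairs_eq_sum:
  "real (near_pairs x r N) = (\<Sum>i\<in>{1..N}. \<Sum>j\<in>{1..N}. of_bool (dist_int (x i - x j) \<le> r))"
proof -
  have "{(m, n). m \<in> {1..N} \<and> n \<in> {1..N} \<and> dist_int (x m - x n) \<le> r}
      = {z \<in> {1..N} \<times> {1..N}. dist_int (x (fst z) - x (snd z)) \<le> r}" by auto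
  then show ?thesis
    unfolding near_pairs_def
    by (simp only: card_filter_eq_sum finite_cartesian_product finite_atLeastAtMost
        sum.cartesian_product case_prod_unfold)
qed

lemma near_pairs_mono: "r \<le> s \<Longrightarrow> near_pairs x r N \<le> near_pairs x s N"
  unfolding near_pairs_def
  by (rule card_mono, rule finite_subset[of _ "{1..N} \<times> {1..N}"]) auto

lemma window_eq_sum:
  "real (window M L x N c) = (\<Sum>i\<in>{1..N}. of_bool ((\<lfloor>real M * x i\<rfloor> - c) mod int M < int L))"
  unfolding window_def by (rule card_filter_eq_sum) simp

lemma window_mod: "window M L x N (c mod int M) = window M L x N c"
  unfolding window_def by (simp add: mod_diff_right_eq)

lemma sum_mod_shift:
  fixes f :: "int \<Rightarrow> 'a::comm_monoid_add"
  assumes "M > 0"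
  shows "(\<Sum>c\<in>{0..<int M}. f ((c + h) mod int M)) = (\<Sum>c\<in>{0..<int M}. f c)"
  by (rule sum.reindex_bij_witness[of _ "\<lambda>c. (c - h) mod int M" "\<lambda>c. (c + h) mod int M"])
     (use assms in \<open>auto simp: mod_simps\<close>)

text \<open>A point in box \<open>B\<close> lies in the window at \<open>c\<close> exactly when
  \<open>c\<close> is one of the \<open>L\<close> residues \<open>B - u\<close>,
  \<open>0 \<le> u < L\<close>.\<close>

lemma sum_window:
  assumes "0 < M" "L \<le> M"
  shows "(\<Sum>c\<in>{0..<int M}. real (window M L x N c)) = real L * real N"
proof -
  have *: "(\<Sum>c\<in>{0..<int M}. of_bool ((B - c) mod int M < int L) :: real) = real L" for B
  proof -
    have "card {c \<in> {0..<int M}. (B - c) mod int M < int L} = card {0..<int L}"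
      by (rule bij_betw_same_card[where f = "\<lambda>c. (B - c) mod int M"],
          rule bij_betw_byWitness[where f' = "\<lambda>u. (B - u) mod int M"])
         (use assms in \<open>auto simp: mod_simps\<close>)
    then show ?thesis
      by (simp only: finite_atLeastLessThan_int card_atLeastLessThan_int flip: card_filter_eq_sum)
  qed
  show ?thesis
    unfolding window_eq_sum by (subst sum.swap) (simp add: * algebra_simps)
qed

text \<open>Boxes at cyclic distance \<open>d < L\<close> share \<open>L - d\<close> windows, and
  points in them are within \<open>l / M\<close> of each other for each of the \<open>L - d\<close>
  values \<open>l \<in> {d+1..L}\<close>. For \<open>d \<ge> L\<close> there is no common
  window.\<close>

lemma card_common_windows_le:
  fixes y z :: real
  assumes "0 < M" "2 * L \<le> M"
  shows "card {c \<in> {0..<int M}. (\<lfloor>real M * y\<rfloor> - c) mod int M < int L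
                \<and> (\<lfloor>real M * z\<rfloor> - c) mod int M < int L}
       \<le> card {l \<in> {1..L}. dist_int (y - z) \<le> real l / real M}"
proof -
  define u where "u c = (\<lfloor>real M * y\<rfloor> - c) mod int M" for c
  define v where "v c = (\<lfloor>real M * z\<rfloor> - c) mod int M" for c
  define S where "S = {c \<in> {0..<int M}. u c < int L \<and> v c < int L}"
  \<comment> \<open>On \<open>S\<close> both offsets are below \<open>L\<close>, so \<open>L\<close>
    minus the smaller one exceeds their distance.\<close>
  define F where "F c = L - nat (min (u c) (v c))" for c
  have uv0: "0 \<le> u c" "0 \<le> v c" for c using assms by (auto simp: u_def v_def)
  have t: "\<exists>t. \<lfloor>real M * y\<rfloor> - \<lfloor>real M * z\<rfloor> = u c - v c + int M * t" for c
  proof -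
    have "\<lfloor>real M * y\<rfloor> - c = int M * ((\<lfloor>real M * y\<rfloor> - c) div int M) + u c"
         "\<lfloor>real M * z\<rfloor> - c = int M * ((\<lfloor>real M * z\<rfloor> - c) div int M) + v c"
      unfolding u_def v_def by simp_all
    then have "\<lfloor>real M * y\<rfloor> - \<lfloor>real M * z\<rfloor> = u c - v c
        + int M * ((\<lfloor>real M * y\<rfloor> - c) div int M - (\<lfloor>real M * z\<rfloor> - c) div int M)"
      by (simp only: right_diff_distrib)
    then show ?thesis by blast
  qed
  have "inj_on F S"
  proof (rule inj_onI)
    fix c c' assume c: "c \<in> S" "c' \<in> S" and F: "F c = F c'"
    obtain t1 t2 where t12: "\<lfloor>real M * y\<rfloor> - \<lfloor>real M * z\<rfloor> = u c - v c + int M * t1"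
        "\<lfloor>real M * y\<rfloor> - \<lfloor>real M * z\<rfloor> = u c' - v c' + int M * t2"
      using t by blast
    have b: "u c < int L" "v c < int L" "u c' < int L" "v c' < int L"
      using c by (auto simp: S_def)
    \<comment> \<open>Modulo \<open>M\<close> the difference of the offsets does not depend on the
      window. Both differences are below \<open>L\<close> in absolute value, so
      \<open>2 * L \<le> M\<close> makes them equal.\<close>
    have "(u c - v c) - (u c' - v c') = int M * (t2 - t1)"
      using t12 by (simp add: algebra_simps)
    moreover have "\<bar>(u c - v c) - (u c' - v c')\<bar> < int M"
      using b uv0[of c] uv0[of c'] assms by linarith
    ultimately have "u c - v c = u c' - v c'"
      using dvd_imp_le_int[of "(u c - v c) - (u c' - v c')" "int M"] by fastforce
    moreover have "min (u c) (v c) = min (u c') (v c')"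
      using F b uv0[of c] uv0[of c'] unfolding F_def by linarith
    ultimately have "u c = u c'" by linarith
    then have "(\<lfloor>real M * y\<rfloor> - (\<lfloor>real M * y\<rfloor> - c) mod int M) mod int M
        = (\<lfloor>real M * y\<rfloor> - (\<lfloor>real M * y\<rfloor> - c') mod int M) mod int M"
      unfolding u_def by simp
    then have "c mod int M = c' mod int M" by (simp add: mod_simps)
    then show "c = c'" using c by (simp add: S_def)
  qed
  moreover have "F ` S \<subseteq> {l \<in> {1..L}. dist_int (y - z) \<le> real l / real M}"
  proof
    fix l assume "l \<in> F ` S"
    then obtain c where c: "u c < int L" "v c < int L" "l = F c" by (auto simp: S_def)
    obtain t1 where t1: "\<lfloor>real M * y\<rfloor> - \<lfloor>real M * z\<rfloor> = u c - v c + int M * t1"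
      using t by blast
    have l: "\<bar>u c - v c\<bar> + 1 \<le> int l" "l \<le> L"
      using c uv0[of c] unfolding F_def by linarith+
    have "of_int (\<lfloor>real M * y\<rfloor> - \<lfloor>real M * z\<rfloor>) = of_int (u c - v c) + real M * of_int t1"
      unfolding t1 by simp
    moreover have "\<bar>real_of_int (u c - v c)\<bar> + 1 \<le> real l" using l(1) by linarith
    ultimately have "\<bar>real M * y - real M * z - real M * of_int t1\<bar> \<le> real l"
      by linarith
    moreover have "real M * y - real M * z - real M * of_int t1 = real M * (y - z - of_int t1)"
      by (simp add: algebra_simps)
    ultimately have "real M * \<bar>y - z - of_int t1\<bar> \<le> real l"
      by (simp only: abs_mult abs_of_nat)
    then have "\<bar>y - z - of_int t1\<bar> \<le> real l / real M"
      using assms by (simp only: pos_le_divide_eq of_nat_0_less_iff mult.commute)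
    then have "dist_int (y - z) \<le> real l / real M"
      using dist_int_le[of "y - z" t1] by linarith
    then show "l \<in> {l \<in> {1..L}. dist_int (y - z) \<le> real l / real M}" using l by auto
  qed
  ultimately have "card S \<le> card {l \<in> {1..L}. dist_int (y - z) \<le> real l / real M}"
    by (intro card_inj_on_le) auto
  then show ?thesis by (simp add: S_def u_def v_def)
qed

text \<open>Squaring a window count counts ordered pairs of points in the window. Over all windows a
  pair contributes its number of common windows, at most the number of scales \<open>l / M\<close>
  at which it is near.\<close>

lemma sum_window_sq_le:
  assumes "0 < M" "2 * L \<le> M"
  shows "(\<Sum>c\<in>{0..<int M}. (real (window M L x N c))\<^sup>2)
       \<le> (\<Sum>l\<in>{1..L}. real (near_pairs x (real l / real M) N))"
proof -
  let ?I = "\<lambda>c i. (\<lfloor>real M * x i\<rfloor> - c) mod int M < int L"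
  let ?D = "\<lambda>i j l. dist_int (x i - x j) \<le> real l / real M"
  have pair: "(\<Sum>c\<in>{0..<int M}. of_bool (?I c i \<and> ?I c j)) \<le> (\<Sum>l\<in>{1..L}. of_bool (?D i j l) :: real)"
    for i j
    using card_common_windows_le[OF assms, of "x i" "x j"]
    by (simp only: finite_atLeastLessThan_int finite_atLeastAtMost of_nat_le_iff
        flip: card_filter_eq_sum)
  have "(\<Sum>c\<in>{0..<int M}. (real (window M L x N c))\<^sup>2)
      = (\<Sum>c\<in>{0..<int M}. \<Sum>i\<in>{1..N}. \<Sum>j\<in>{1..N}. of_bool (?I c i \<and> ?I c j))"
    unfolding window_eq_sum power2_eq_square sum_product by (simp add: of_bool_conj)
  also have "\<dots> = (\<Sum>i\<in>{1..N}. \<Sum>j\<in>{1..N}. \<Sum>c\<in>{0..<int M}. of_bool (?I c i \<and> ?I c j))"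
    by (subst sum.swap, subst (2) sum.swap) (rule refl)
  also have "\<dots> \<le> (\<Sum>i\<in>{1..N}. \<Sum>j\<in>{1..N}. \<Sum>l\<in>{1..L}. of_bool (?D i j l))"
    by (intro sum_mono pair)
  also have "\<dots> = (\<Sum>l\<in>{1..L}. \<Sum>i\<in>{1..N}. \<Sum>j\<in>{1..N}. of_bool (?D i j l))"
    by (subst (2) sum.swap, subst sum.swap) (rule refl)
  finally show ?thesis by (simp add: near_pairs_eq_sum)
qed

text \<open>Choosing for each point of a near pair one of the \<open>L\<close> windows containing it
  gives \<open>L\<^sup>2\<close> pairs of windows, with shifts between \<open>- H\<close> and
  \<open>H\<close>. For each of these \<open>2 * H + 1\<close> shifts, AM-GM and rotation invariance
  bound the sum of \<open>?W c * ?W (c + h)\<close> by the sum of squares.\<close>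

lemma near_pairs_le_sum_window_sq:
  assumes "0 < M" "L \<le> M" and H: "real M * r + real L \<le> real H"
  shows "(real L)\<^sup>2 * real (near_pairs x r N)
       \<le> (2 * real H + 1) * (\<Sum>c\<in>{0..<int M}. (real (window M L x N c))\<^sup>2)"
proof -
  let ?I = "\<lambda>c i. (\<lfloor>real M * x i\<rfloor> - c) mod int M < int L"
  let ?W = "\<lambda>c. real (window M L x N c)"
  let ?C = "{0..<int M}" and ?Hs = "{- int H..int H}"
  have pair: "(real L)\<^sup>2 * of_bool (dist_int (x i - x j) \<le> r)
      \<le> (\<Sum>c\<in>?C. \<Sum>h\<in>?Hs. of_bool (?I c i \<and> ?I (c + h) j) :: real)" for i j
  proof (cases "dist_int (x i - x j) \<le> r")
    case True
    define Bi where "Bi = \<lfloor>real M * x i\<rfloor>"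
    define Bj where "Bj = \<lfloor>real M * x j\<rfloor>"
    obtain t where t: "dist_int (x i - x j) = \<bar>x i - x j - of_int t\<bar>"
      by (rule dist_int_attained)
    \<comment> \<open>\<open>E\<close> is the difference of the box numbers, lifted by
      \<open>t\<close> turns to the representative near zero; the two floors together change it by
      less than \<open>1\<close>.\<close>
    define E where "E = Bj - Bi + int M * t"
    have "\<bar>real M * (x i - x j - of_int t)\<bar> \<le> real M * r"
      using True t assms by (simp add: abs_mult)
    moreover have "real M * (x i - x j - of_int t) = real M * x i - real M * x j - real M * of_int t"
      by (simp add: algebra_simps)
    moreover have "real_of_int E = of_int Bj - of_int Bi + real M * of_int t" by (simp add: E_def)
    ultimately have E: "\<bar>real_of_int E\<bar> < real M * r + 1"
      unfolding Bi_def Bj_def by linarith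
    define K where "K = {(c, h) \<in> ?C \<times> ?Hs. ?I c i \<and> ?I (c + h) j}"
    \<comment> \<open>Offsets \<open>(u, v)\<close> yield the window with the box of
      \<open>x i\<close> at offset \<open>u\<close>, and the shift from it to the window with the
      box of \<open>x j\<close> at offset \<open>v\<close>.\<close>
    define G where "G = (\<lambda>(u, v). ((Bi - u) mod int M, E + u - v))"
    have inj: "inj_on G ({0..<int L} \<times> {0..<int L})"
    proof (rule inj_onI)
      fix a b assume a: "a \<in> {0..<int L} \<times> {0..<int L}" and b: "b \<in> {0..<int L} \<times> {0..<int L}"
        and eq: "G a = G b"
      obtain u v where uv: "a = (u, v)" by (cases a)
      obtain u' v' where uv': "b = (u', v')" by (cases b)
      have "(Bi - (Bi - u) mod int M) mod int M = (Bi - (Bi - u') mod int M) mod int M"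
        using eq by (simp add: G_def uv uv')
      then have "u mod int M = u' mod int M" by (simp add: mod_simps)
      then have "u = u'" using a b uv uv' assms(2) by auto
      then show "a = b" using eq by (simp add: G_def uv uv')
    qed
    have "G ` ({0..<int L} \<times> {0..<int L}) \<subseteq> K"
    proof
      fix w assume "w \<in> G ` ({0..<int L} \<times> {0..<int L})"
      then obtain u v where uv: "0 \<le> u" "u < int L" "0 \<le> v" "v < int L"
        and w: "w = ((Bi - u) mod int M, E + u - v)" by (auto simp: G_def)
      \<comment> \<open>Since \<open>\<bar>E\<bar> < M * r + 1\<close> and
        \<open>\<bar>u - v\<bar> \<le> L - 1\<close>, the units cancel and the bound assumed of
        \<open>H\<close> remains.\<close>
      have "\<bar>real_of_int (E + u - v)\<bar> \<le> real H"
        using E uv H by linarith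
      then have 1: "E + u - v \<in> ?Hs" by auto
      have 2: "(Bi - (Bi - u) mod int M) mod int M = u"
        using uv assms by (simp add: mod_simps)
      have "(Bj - ((Bi - u) mod int M + (E + u - v))) mod int M
          = (Bj - ((Bi - u) + (E + u - v))) mod int M"
        by (metis mod_add_left_eq mod_diff_right_eq)
      also have "Bj - ((Bi - u) + (E + u - v)) = v + int M * (- t)"
        unfolding E_def by (simp add: algebra_simps)
      also have "(v + int M * (- t)) mod int M = v" using uv assms by (simp del: mult_minus_right)
      finally show "w \<in> K" using 1 2 uv assms unfolding K_def w
        by (simp add: Bi_def Bj_def)
    qed
    moreover have finK: "finite K" unfolding K_def by (rule finite_subset[of _ "?C \<times> ?Hs"]) auto
    ultimately have "card ({0..<int L} \<times> {0..<int L}) \<le> card K"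
      using inj by (intro card_inj_on_le)
    then have "(real L)\<^sup>2 \<le> real (card K)"
      by (simp add: power2_eq_square flip: of_nat_mult)
    moreover have "real (card K) = (\<Sum>z\<in>?C \<times> ?Hs. of_bool (?I (fst z) i \<and> ?I (fst z + snd z) j))"
    proof -
      have "K = {z \<in> ?C \<times> ?Hs. ?I (fst z) i \<and> ?I (fst z + snd z) j}" by (auto simp: K_def)
      then show ?thesis by (simp only: card_filter_eq_sum finite_cartesian_product
          finite_atLeastLessThan_int finite_atLeastAtMost_int)
    qed
    ultimately show ?thesis
      using True by (simp only: sum.cartesian_product case_prod_unfold of_bool_eq mult_1_right)
  qed (auto intro!: sum_nonneg)
  have "(real L)\<^sup>2 * real (near_pairs x r N)
      = (\<Sum>i\<in>{1..N}. \<Sum>j\<in>{1..N}. (real L)\<^sup>2 * of_bool (dist_int (x i - x j) \<le> r))"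
    by (simp only: near_pairs_eq_sum sum_distrib_left)
  also have "\<dots> \<le> (\<Sum>i\<in>{1..N}. \<Sum>j\<in>{1..N}. \<Sum>c\<in>?C. \<Sum>h\<in>?Hs. of_bool (?I c i \<and> ?I (c + h) j))"
    by (intro sum_mono pair)
  also have "\<dots> = (\<Sum>i\<in>{1..N}. \<Sum>c\<in>?C. \<Sum>h\<in>?Hs. \<Sum>j\<in>{1..N}. of_bool (?I c i \<and> ?I (c + h) j))"
    by (subst (2) sum.swap, subst (3) sum.swap) (rule refl)
  also have "\<dots> = (\<Sum>h\<in>?Hs. \<Sum>c\<in>?C. \<Sum>i\<in>{1..N}. \<Sum>j\<in>{1..N}. of_bool (?I c i \<and> ?I (c + h) j))"
    by (subst sum.swap, subst (2) sum.swap, subst sum.swap) (rule refl)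
  also have "\<dots> = (\<Sum>h\<in>?Hs. \<Sum>c\<in>?C. ?W c * ?W (c + h))"
    unfolding window_eq_sum sum_product by (simp add: of_bool_conj)
  also have "\<dots> \<le> (\<Sum>h\<in>?Hs. \<Sum>c\<in>?C. (?W c)\<^sup>2)"
  proof (rule sum_mono)
    fix h
    have "(\<Sum>c\<in>?C. ?W c * ?W (c + h)) \<le> (\<Sum>c\<in>?C. ((?W c)\<^sup>2 + (?W (c + h))\<^sup>2) / 2)"
    proof (rule sum_mono)
      fix c show "?W c * ?W (c + h) \<le> ((?W c)\<^sup>2 + (?W (c + h))\<^sup>2) / 2"
        using sum_squares_bound[of "?W c" "?W (c + h)"] by simp
    qed
    also have "\<dots> = ((\<Sum>c\<in>?C. (?W c)\<^sup>2) + (\<Sum>c\<in>?C. (?W ((c + h) mod int M))\<^sup>2)) / 2"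
      by (simp add: sum.distrib window_mod flip: sum_divide_distrib)
    also have "(\<Sum>c\<in>?C. (?W ((c + h) mod int M))\<^sup>2) = (\<Sum>c\<in>?C. (?W c)\<^sup>2)"
      by (rule sum_mod_shift[where f = "\<lambda>c. (?W c)\<^sup>2"]) (fact assms)
    finally show "(\<Sum>c\<in>?C. ?W c * ?W (c + h)) \<le> (\<Sum>c\<in>?C. (?W c)\<^sup>2)" by simp
  qed
  also have "\<dots> = (2 * real H + 1) * (\<Sum>c\<in>?C. (?W c)\<^sup>2)" by simp
  finally show ?thesis .
qed

text \<open>\<open>S\<close> collects the windows meeting the boxes from that of \<open>a\<close> to
  that of \<open>b\<close>, so it contains all \<open>L\<close> windows around any point of the
  interval. Its size exceeds \<open>M * (b - a)\<close> by at most the edge effect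
  \<open>L + 1\<close>.\<close>

lemma card_interval_le_sum_window:
  assumes "0 < M" "L \<le> M" "a \<le> b"
  obtains S where "S \<subseteq> {0..<int M}" "real (card S) \<le> real M * (b - a) + real L + 1"
    "real L * real (card {i \<in> {1..N}. x i \<in> {a..b}}) \<le> (\<Sum>c\<in>S. real (window M L x N c))"
proof -
  define T where "T = {\<lfloor>real M * a\<rfloor> - int L<..\<lfloor>real M * b\<rfloor>}"
  define S where "S = (\<lambda>c. c mod int M) ` T"
  let ?I = "\<lambda>c i. (\<lfloor>real M * x i\<rfloor> - c) mod int M < int L"
  have ab: "real M * a \<le> real M * b" using assms by (intro mult_left_mono) auto
  have 1: "S \<subseteq> {0..<int M}" using assms by (auto simp: S_def)
  have finT: "finite T" by (simp add: T_def)
  then have finS: "finite S" by (simp add: S_def)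
  have "card S \<le> card T" unfolding S_def using finT by (rule card_image_le)
  moreover have "card T = nat (\<lfloor>real M * b\<rfloor> - \<lfloor>real M * a\<rfloor> + int L)" by (simp add: T_def)
  moreover have "\<lfloor>real M * a\<rfloor> \<le> \<lfloor>real M * b\<rfloor>" using ab by (rule floor_mono)
  ultimately have "real (card S) \<le> of_int (\<lfloor>real M * b\<rfloor> - \<lfloor>real M * a\<rfloor> + int L)" by linarith
  then have 2: "real (card S) \<le> real M * (b - a) + real L + 1"
    unfolding right_diff_distrib by simp linarith
  have pt: "real L * of_bool (x i \<in> {a..b}) \<le> (\<Sum>c\<in>S. of_bool (?I c i) :: real)" for i
  proof (cases "x i \<in> {a..b}")
    case True
    define B where "B = \<lfloor>real M * x i\<rfloor>"
    have "real M * a \<le> real M * x i" "real M * x i \<le> real M * b"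
      using True assms by (auto intro!: mult_left_mono)
    then have B: "\<lfloor>real M * a\<rfloor> \<le> B" "B \<le> \<lfloor>real M * b\<rfloor>"
      unfolding B_def by (auto intro: floor_mono)
    have "card {0..<int L} \<le> card {c \<in> S. ?I c i}"
    proof (rule card_inj_on_le)
      show "inj_on (\<lambda>u. (B - u) mod int M) {0..<int L}"
      proof (rule inj_onI)
        fix u v assume uv: "u \<in> {0..<int L}" "v \<in> {0..<int L}"
          and "(B - u) mod int M = (B - v) mod int M"
        then have "(B - (B - u) mod int M) mod int M = (B - (B - v) mod int M) mod int M" by simp
        then have "u mod int M = v mod int M" by (simp add: mod_simps)
        then show "u = v" using uv assms by auto
      qed
      show "(\<lambda>u. (B - u) mod int M) ` {0..<int L} \<subseteq> {c \<in> S. ?I c i}"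
      proof
        fix c assume "c \<in> (\<lambda>u. (B - u) mod int M) ` {0..<int L}"
        then obtain u where u: "0 \<le> u" "u < int L" "c = (B - u) mod int M" by auto
        have "B - u \<in> T" using u B by (auto simp: T_def)
        then have "c \<in> S" unfolding S_def u(3) by (rule imageI)
        moreover have "(B - c) mod int M = u" using u assms by (simp add: mod_simps)
        ultimately show "c \<in> {c \<in> S. ?I c i}" using u by (simp add: B_def)
      qed
    qed (use finS in auto)
    then have "real L \<le> real (card {c \<in> S. ?I c i})" by simp
    also have "\<dots> = (\<Sum>c\<in>S. of_bool (?I c i))"
      using finS by (rule card_filter_eq_sum)
    finally show ?thesis using True by simp
  qed (auto intro!: sum_nonneg)
  have "real L * real (card {i \<in> {1..N}. x i \<in> {a..b}})
      = (\<Sum>i\<in>{1..N}. real L * of_bool (x i \<in> {a..b}))"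
    by (simp only: card_filter_eq_sum finite_atLeastAtMost sum_distrib_left)
  also have "\<dots> \<le> (\<Sum>i\<in>{1..N}. \<Sum>c\<in>S. of_bool (?I c i))" by (intro sum_mono pt)
  also have "\<dots> = (\<Sum>c\<in>S. real (window M L x N c))"
    unfolding window_eq_sum by (rule sum.swap)
  finally show ?thesis using 1 2 by (rule that[rotated 2])
qed

subsection \<open>Tuples of distinct indices\<close>

definition tuples ::
  "nat \<Rightarrow> real \<Rightarrow> (nat \<Rightarrow> real) \<Rightarrow> (nat \<Rightarrow> real) \<Rightarrow> (nat \<Rightarrow> real) \<Rightarrow> nat \<Rightarrow> (nat \<Rightarrow> nat) set" where
  "tuples m \<beta> x a b N = {i \<in> {1..m} \<rightarrow>\<^sub>E {1..N}. inj_on i {1..m} \<and>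
     (\<forall>j\<in>{1..m-1}. real N powr \<beta> * signed_res (x (i 1) - x (i (j + 1))) \<in> {a j..b j})}"

definition neighbours :: "real \<Rightarrow> (nat \<Rightarrow> real) \<Rightarrow> real \<Rightarrow> real \<Rightarrow> nat \<Rightarrow> nat \<Rightarrow> nat set" where
  "neighbours \<beta> x c d N n =
     {j \<in> {1..N} - {n}. real N powr \<beta> * signed_res (x n - x j) \<in> {c..d}}"

lemma corr_rectangle:
  "corr m \<beta> x (rectangle (m-1) a b) N
     = real (card (tuples m \<beta> x a b N)) / real N powr (real m - (real m - 1) * \<beta>)"
  unfolding corr_def tuples_def rectangle_def PiE_iff by simp

lemma finite_tuples [simp]: "finite (tuples m \<beta> x a b N)"
  unfolding tuples_def by (rule finite_subset[of _ "{1..m} \<rightarrow>\<^sub>E {1..N}"]) (auto intro: finite_PiE)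

lemma finite_neighbours [simp]: "finite (neighbours \<beta> x c d N n)"
  unfolding neighbours_def by simp

lemma card_neighbours_mono:
  "c' \<le> c \<Longrightarrow> d \<le> d' \<Longrightarrow> card (neighbours \<beta> x c d N n) \<le> card (neighbours \<beta> x c' d' N n)"
  by (rule card_mono) (auto simp: neighbours_def)

lemma sum_tuples_1:
  fixes h :: "nat \<Rightarrow> 'a::comm_monoid_add"
  shows "(\<Sum>i\<in>tuples 1 \<beta> x a b N. h (i 1)) = (\<Sum>n\<in>{1..N}. h n)"
  by (rule sum.reindex_bij_witness[of _ "\<lambda>n. \<lambda>j\<in>{1}. n" "\<lambda>i. i 1"])
     (auto simp: tuples_def PiE_iff extensional_def fun_eq_iff)

text \<open>The last index is constrained only by \<open>i 1\<close> and by the indices already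
  used. The weight \<open>h\<close> on the first index lets this recursion be iterated.\<close>

lemma sum_tuples_Suc:
  fixes h :: "nat \<Rightarrow> real"
  assumes "m \<ge> 1"
  shows "(\<Sum>i\<in>tuples (Suc m) \<beta> x a b N. h (i 1))
       = (\<Sum>i\<in>tuples m \<beta> x a b N. h (i 1) * real (card (neighbours \<beta> x (a m) (b m) N (i 1) - i ` {1..m})))"
proof -
  let ?T = "tuples m \<beta> x a b N"
  let ?S = "\<lambda>i. neighbours \<beta> x (a m) (b m) N (i 1) - i ` {1..m}"
  have S: "{1..Suc m} = insert (Suc m) {1..m}" by auto
  have "(\<Sum>i\<in>tuples (Suc m) \<beta> x a b N. h (i 1)) = (\<Sum>(i, j)\<in>Sigma ?T ?S. h (i 1))"
  proof (rule sum.reindex_bij_witness[of _ "\<lambda>(i, j). i(Suc m := j)"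
        "\<lambda>i. (restrict i {1..m}, i (Suc m))"])
    fix i assume i: "i \<in> tuples (Suc m) \<beta> x a b N"
    show "(case (restrict i {1..m}, i (Suc m)) of (i, j) \<Rightarrow> i(Suc m := j)) = i"
      using i by (auto simp: tuples_def fun_eq_iff PiE_iff extensional_def)
    have inj: "inj_on i {1..m}" "i (Suc m) \<notin> i ` {1..m}"
      using i unfolding tuples_def S inj_on_insert by (auto simp del: One_nat_def)
    have mem: "real N powr \<beta> * signed_res (x (i 1) - x (i (j + 1))) \<in> {a j..b j}" if "j \<in> {1..m}" for j
      using i that by (auto simp: tuples_def)
    have rng: "i j \<in> {1..N}" if "j \<in> {1..Suc m}" for j using i that by (auto simp: tuples_def)
    have "restrict i {1..m} \<in> ?T"
      using inj mem rng assms by (auto simp: tuples_def inj_on_restrict_eq)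
    moreover have "i (Suc m) \<in> neighbours \<beta> x (a m) (b m) N (i 1)"
      using inj(2) mem[of m] rng[of "Suc m"] assms by (auto simp: neighbours_def image_iff)
    ultimately show "(restrict i {1..m}, i (Suc m)) \<in> Sigma ?T ?S"
      using inj assms by auto
  next
    fix z assume "z \<in> Sigma ?T ?S"
    then obtain i j where z: "z = (i, j)" and i: "i \<in> ?T" and j: "j \<in> ?S i" by auto
    have i0: "i (Suc m) = undefined" using i by (auto simp: tuples_def PiE_iff extensional_def)
    show "(restrict (case z of (i, j) \<Rightarrow> i(Suc m := j)) {1..m}, (case z of (i, j) \<Rightarrow> i(Suc m := j)) (Suc m)) = z"
      using i z by (auto simp: fun_eq_iff tuples_def PiE_iff extensional_def)
    have "inj_on (i(Suc m := j)) {1..Suc m}"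
    proof -
      have "inj_on (i(Suc m := j)) {1..m} \<longleftrightarrow> inj_on i {1..m}"
        by (rule inj_on_cong) auto
      moreover have "(i(Suc m := j)) ` {1..m} = i ` {1..m}" by (rule image_cong) auto
      ultimately show ?thesis
        using i j unfolding S inj_on_insert by (auto simp: tuples_def)
    qed
    moreover have "i(Suc m := j) \<in> {1..Suc m} \<rightarrow>\<^sub>E {1..N}"
      using i j by (auto simp: tuples_def neighbours_def PiE_iff extensional_def)
    moreover have "real N powr \<beta> * signed_res (x ((i(Suc m := j)) 1) - x ((i(Suc m := j)) (l + 1))) \<in> {a l..b l}"
      if "l \<in> {1..m}" for l
    proof (cases "l = m")
      case True
      then show ?thesis using j assms by (auto simp: neighbours_def)
    next
      case False
      then have "l \<in> {1..m-1}" using that by auto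
      then show ?thesis using i assms False by (auto simp: tuples_def)
    qed
    ultimately show "(case z of (i, j) \<Rightarrow> i(Suc m := j)) \<in> tuples (Suc m) \<beta> x a b N"
      by (auto simp: z tuples_def)
  qed (use assms in auto)
  also have "\<dots> = (\<Sum>i\<in>?T. \<Sum>j\<in>?S i. h (i 1))"
    by (subst sum.Sigma) (auto intro: finite_subset[OF _ finite_neighbours])
  finally show ?thesis by (simp add: mult.commute)
qed

lemma card_Diff_image_ge:
  assumes "finite A" "m \<le> p"
  shows "max 0 (real (card A) - real p) \<le> real (card (A - i ` {1..m}))"
proof -
  have "card A - card (i ` {1..m}) \<le> card (A - i ` {1..m})"
    by (rule diff_card_le_card_Diff) simp
  moreover have "card (i ` {1..m}) \<le> m"
    using card_image_le[of "{1..m}" i] by simp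
  ultimately show ?thesis using assms by linarith
qed

lemma tuples_first: "m \<ge> 1 \<Longrightarrow> i \<in> tuples m \<beta> x a b N \<Longrightarrow> i 1 \<in> {1..N}"
  by (auto simp: tuples_def)

text \<open>Each further index has to avoid at most \<open>p\<close> indices used before. The
  resulting factor depends on the first index alone, so the induction absorbs it into
  \<open>h\<close>; truncation at \<open>0\<close> keeps the new weight non-negative.\<close>

lemma sum_tuples_lower:
  assumes "m \<ge> 1" "m \<le> Suc p" "\<And>n. n \<in> {1..N} \<Longrightarrow> h n \<ge> 0"
  shows "(\<Sum>n\<in>{1..N}. h n * max 0 (real (card (neighbours \<beta> x c d N n)) - real p) ^ (m - 1))
       \<le> (\<Sum>i\<in>tuples m \<beta> x (\<lambda>_. c) (\<lambda>_. d) N. h (i 1))"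
  using assms
proof (induction m arbitrary: h rule: dec_induct)
  case base
  then show ?case using sum_tuples_1[where h = h] by simp
next
  case (step m)
  let ?g = "\<lambda>n. max 0 (real (card (neighbours \<beta> x c d N n)) - real p)"
  have "(\<Sum>n\<in>{1..N}. h n * ?g n ^ (Suc m - 1)) = (\<Sum>n\<in>{1..N}. (h n * ?g n) * ?g n ^ (m - 1))"
    using step.hyps by (cases m) (auto simp: mult_ac)
  also have "\<dots> \<le> (\<Sum>i\<in>tuples m \<beta> x (\<lambda>_. c) (\<lambda>_. d) N. h (i 1) * ?g (i 1))"
    by (rule step.IH[of "\<lambda>n. h n * ?g n"]) (use step.prems in auto)
  also have "\<dots> \<le> (\<Sum>i\<in>tuples m \<beta> x (\<lambda>_. c) (\<lambda>_. d) N.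
      h (i 1) * real (card (neighbours \<beta> x c d N (i 1) - i ` {1..m})))"
  proof (intro sum_mono mult_left_mono card_Diff_image_ge)
    fix i assume "i \<in> tuples m \<beta> x (\<lambda>_. c) (\<lambda>_. d) N"
    then show "0 \<le> h (i 1)" using step.hyps step.prems by (blast dest: tuples_first)
  qed (use step.prems in auto)
  also have "\<dots> = (\<Sum>i\<in>tuples (Suc m) \<beta> x (\<lambda>_. c) (\<lambda>_. d) N. h (i 1))"
    using step.hyps by (subst sum_tuples_Suc) auto
  finally show ?case .
qed

text \<open>Dropping distinctness and enlarging all intervals to \<open>{c..d}\<close> makes the
  number of choices for each further index a function of the first index, which again goes into the
  weight.\<close>

lemma sum_tuples_upper:
  assumes "m \<ge> 1" "\<And>j. j \<in> {1..m-1} \<Longrightarrow> c \<le> a j" "\<And>j. j \<in> {1..m-1} \<Longrightarrow> b j \<le> d"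
    "\<And>n. n \<in> {1..N} \<Longrightarrow> h n \<ge> 0"
  shows "(\<Sum>i\<in>tuples m \<beta> x a b N. h (i 1))
       \<le> (\<Sum>n\<in>{1..N}. h n * real (card (neighbours \<beta> x c d N n)) ^ (m - 1))"
  using assms
proof (induction m arbitrary: h rule: dec_induct)
  case base
  then show ?case using sum_tuples_1[where h = h] by simp
next
  case (step m)
  let ?g = "\<lambda>n. real (card (neighbours \<beta> x c d N n))"
  have "(\<Sum>i\<in>tuples (Suc m) \<beta> x a b N. h (i 1))
      = (\<Sum>i\<in>tuples m \<beta> x a b N. h (i 1) * real (card (neighbours \<beta> x (a m) (b m) N (i 1) - i ` {1..m})))"
    using step.hyps(1) by (rule sum_tuples_Suc)
  also have "\<dots> \<le> (\<Sum>i\<in>tuples m \<beta> x a b N. h (i 1) * ?g (i 1))"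
  proof (intro sum_mono mult_left_mono)
    fix i assume i: "i \<in> tuples m \<beta> x a b N"
    have "card (neighbours \<beta> x (a m) (b m) N (i 1) - i ` {1..m}) \<le> card (neighbours \<beta> x (a m) (b m) N (i 1))"
      by (rule card_mono) auto
    also have "\<dots> \<le> card (neighbours \<beta> x c d N (i 1))"
      using step by (intro card_neighbours_mono) auto
    finally show "real (card (neighbours \<beta> x (a m) (b m) N (i 1) - i ` {1..m})) \<le> ?g (i 1)" by simp
    show "0 \<le> h (i 1)" using step.hyps step.prems i by (blast dest: tuples_first)
  qed
  also have "\<dots> \<le> (\<Sum>n\<in>{1..N}. (h n * ?g n) * ?g n ^ (m - 1))"
    by (rule step.IH[of "\<lambda>n. h n * ?g n"]) (use step.prems in auto)
  also have "\<dots> = (\<Sum>n\<in>{1..N}. h n * ?g n ^ (Suc m - 1))"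
    using step.hyps by (cases m) (auto simp: mult_ac)
  finally show ?case .
qed

subsection \<open>Pair correlations at all scales\<close>

text \<open>One half of a pair correlation limit: the upper limit of the normalised count, diagonal
  pairs included, is at most \<open>2 * t\<close>.\<close>

definition near_pairs_bound :: "real \<Rightarrow> (nat \<Rightarrow> real) \<Rightarrow> real \<Rightarrow> bool" where
  "near_pairs_bound \<alpha> x t \<longleftrightarrow> (\<forall>\<epsilon>>0. \<forall>\<^sub>F N in sequentially.
     real (near_pairs x (t / real N powr \<alpha>) N) \<le> (2 * t + \<epsilon>) * real N powr (2 - \<alpha>))"

lemma tendsto_of_nat_powr_neg: "\<gamma> < 0 \<Longrightarrow> (\<lambda>N. real N powr \<gamma>) \<longlonglongrightarrow> 0"
  by (rule tendsto_neg_powr[OF _ filterlim_real_sequentially])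

lemma eventually_of_nat_powr_ge:
  assumes "\<gamma> > 0"
  shows "\<forall>\<^sub>F N in sequentially. C \<le> real N powr \<gamma>"
proof -
  have "(\<lambda>N. real N powr - \<gamma>) \<longlonglongrightarrow> 0" using assms by (intro tendsto_of_nat_powr_neg) simp
  then have "\<forall>\<^sub>F N in sequentially. real N powr - \<gamma> < 1 / (\<bar>C\<bar> + 1)"
    by (rule order_tendstoD) simp
  with eventually_ge_at_top[of 1] show ?thesis
  proof eventually_elim
    case (elim N)
    then have "\<bar>C\<bar> + 1 < real N powr \<gamma>"
      by (simp add: powr_minus inverse_eq_divide frac_less_eq pos_divide_less_eq)
    then show ?case by linarith
  qed
qed

text \<open>The \<open>N\<close> diagonal pairs account for the last term, which tends to
  \<open>0\<close> when \<open>\<alpha> < 1\<close>.\<close>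

lemma near_pairs_eq_pair_corr:
  assumes "t \<ge> 0" "N \<ge> 1"
  shows "real (near_pairs x (t / real N powr \<alpha>) N) / real N powr (2 - \<alpha>)
       = pair_corr \<alpha> x t N + real N powr (\<alpha> - 1)"
proof -
  let ?P = "{(m, n). m \<in> {1..N} \<and> n \<in> {1..N} \<and> m \<noteq> n \<and> dist_int (x m - x n) \<le> t / real N powr \<alpha>}"
  let ?D = "(\<lambda>n. (n, n)) ` {1..N}"
  have d0: "dist_int 0 = 0" by (simp add: dist_int_def)
  have "{(m, n). m \<in> {1..N} \<and> n \<in> {1..N} \<and> dist_int (x m - x n) \<le> t / real N powr \<alpha>} = ?P \<union> ?D"
    using assms by (auto simp: d0)
  moreover have "card (?P \<union> ?D) = card ?P + card ?D"
    by (rule card_Un_disjoint, rule finite_subset[of _ "{1..N} \<times> {1..N}"]) auto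
  moreover have "card ?D = N" by (subst card_image) (auto simp: inj_on_def)
  ultimately have "near_pairs x (t / real N powr \<alpha>) N = card ?P + N"
    by (simp only: near_pairs_def)
  moreover have "real N / real N powr (2 - \<alpha>) = real N powr (\<alpha> - 1)"
    using assms powr_diff[of "real N" 1 "2 - \<alpha>"] by simp
  ultimately show ?thesis unfolding pair_corr_def by (simp only: of_nat_add add_divide_distrib)
qed

lemma near_pairs_boundI:
  assumes "\<alpha> < 1" "t \<ge> 0"
    and *: "\<And>\<epsilon>. \<epsilon> > 0 \<Longrightarrow> \<forall>\<^sub>F N in sequentially. pair_corr \<alpha> x t N \<le> 2 * t + \<epsilon>"
  shows "near_pairs_bound \<alpha> x t"
  unfolding near_pairs_bound_def
proof (intro allI impI)
  fix \<epsilon> :: real assume "\<epsilon> > 0"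
  have "(\<lambda>N. real N powr (\<alpha> - 1)) \<longlonglongrightarrow> 0"
    using assms(1) by (intro tendsto_of_nat_powr_neg) simp
  then have "\<forall>\<^sub>F N in sequentially. real N powr (\<alpha> - 1) < \<epsilon> / 2"
    by (rule order_tendstoD) (use \<open>\<epsilon> > 0\<close> in simp)
  moreover have "\<forall>\<^sub>F N in sequentially. pair_corr \<alpha> x t N \<le> 2 * t + \<epsilon> / 2"
    using \<open>\<epsilon> > 0\<close> by (intro *) simp
  ultimately show "\<forall>\<^sub>F N in sequentially.
      real (near_pairs x (t / real N powr \<alpha>) N) \<le> (2 * t + \<epsilon>) * real N powr (2 - \<alpha>)"
    using eventually_ge_at_top[of 1]
  proof eventually_elim
    case (elim N)
    then have "real (near_pairs x (t / real N powr \<alpha>) N) / real N powr (2 - \<alpha>) \<le> 2 * t + \<epsilon>"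
      using near_pairs_eq_pair_corr[OF assms(2), of N x \<alpha>] by linarith
    then show ?case using elim by (simp add: pos_divide_le_eq)
  qed
qed

section \<open>Lower bounds by Cauchy-Schwarz\<close>

text \<open>The windows have length about \<open>s / Y\<close>. Their counts add up to
  \<open>L * N\<close>, so Cauchy-Schwarz bounds the sum of squares from below, while
  \<open>sum_window_sq_le\<close> bounds it from above by pair counts.\<close>

lemma sum_near_pairs_lower:
  fixes s Y :: real
  assumes "s > 0" "2 * s \<le> Y" "L \<ge> 1"
  shows "(real L * s - s\<^sup>2 / Y) * ((real N)\<^sup>2 / Y) \<le> (\<Sum>l\<in>{1..L}. real (near_pairs x ((real l * s / real L) / Y) N))"
proof -
  \<comment> \<open>Rounding up keeps \<open>l / M\<close> below the scale wanted for
    \<open>l\<close>, and \<open>2 * s \<le> Y\<close> gives \<open>2 * L \<le> M\<close>.\<close>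
  define M where "M = nat \<lceil>real L * Y / s\<rceil>"
  have Y: "Y > 0" using assms by linarith
  have pos: "real L * Y / s > 0" using assms Y by simp
  have M: "real L * Y / s \<le> real M" "real M \<le> real L * Y / s + 1"
    unfolding M_def using pos by linarith+
  have "2 * real L \<le> real L * Y / s"
    using assms by (simp add: field_simps)
  then have M2: "2 * L \<le> M" using M(1) by linarith
  have M0: "M > 0" using M2 assms by linarith
  let ?W = "\<lambda>c. real (window M L x N c)"
  have "(real L * real N)\<^sup>2 = (\<Sum>c\<in>{0..<int M}. ?W c)\<^sup>2"
    using sum_window[of M L x N] M0 M2 by simp
  also have "\<dots> \<le> (\<Sum>c\<in>{0..<int M}. (?W c)\<^sup>2) * real (card {0..<int M})"
    by (rule sum_squared_le_sum_of_squares)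
  also have "\<dots> \<le> (\<Sum>l\<in>{1..L}. real (near_pairs x (real l / real M) N)) * real M"
    using sum_window_sq_le[OF M0 M2, of x N] by (simp add: mult_right_mono)
  also have "\<dots> \<le> (\<Sum>l\<in>{1..L}. real (near_pairs x ((real l * s / real L) / Y) N)) * real M"
  proof (intro mult_right_mono sum_mono)
    fix l assume "l \<in> {1..L}"
    have "real l / real M \<le> real l / (real L * Y / s)"
      using M(1) pos M0 by (intro divide_left_mono mult_pos_pos) simp_all
    then have "real l / real M \<le> (real l * s / real L) / Y" by (simp add: field_simps)
    then show "real (near_pairs x (real l / real M) N) \<le> real (near_pairs x ((real l * s / real L) / Y) N)"
      by (simp add: near_pairs_mono)
  qed simp
  finally have 1: "(real L * real N)\<^sup>2 \<le> (\<Sum>l\<in>{1..L}. real (near_pairs x ((real l * s / real L) / Y) N)) * real M" .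
  \<comment> \<open>The correction \<open>s\<^sup>2 / Y\<close> pays for the rounding: times
    \<open>L * Y / s\<close> it cancels the extra \<open>L * s\<close> caused by the
    \<open>+ 1\<close> in the bound on \<open>M\<close>.\<close>
  have "(real L * s - s\<^sup>2 / Y) * real M \<le> (real L)\<^sup>2 * Y"
  proof -
    have "s\<^sup>2 / Y \<le> s"
      using assms Y by (simp add: field_simps power2_eq_square)
    also have "s \<le> real L * s" using assms by simp
    finally have "0 \<le> real L * s - s\<^sup>2 / Y" by simp
    then have "(real L * s - s\<^sup>2 / Y) * real M \<le> (real L * s - s\<^sup>2 / Y) * (real L * Y / s + 1)"
      using M(2) by (intro mult_left_mono)
    also have "\<dots> = (real L)\<^sup>2 * Y - s\<^sup>2 / Y"
      using assms Y by (simp add: field_simps power2_eq_square)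
    also have "\<dots> \<le> (real L)\<^sup>2 * Y" using Y by simp
    finally show ?thesis .
  qed
  then have "(real L * s - s\<^sup>2 / Y) * real M * ((real N)\<^sup>2 / Y) \<le> (real L)\<^sup>2 * Y * ((real N)\<^sup>2 / Y)"
    using Y by (intro mult_right_mono) auto
  also have "\<dots> = (real L * real N)\<^sup>2" using Y by (simp add: power_mult_distrib)
  finally have "((real L * s - s\<^sup>2 / Y) * ((real N)\<^sup>2 / Y)) * real M
      \<le> (\<Sum>l\<in>{1..L}. real (near_pairs x ((real l * s / real L) / Y) N)) * real M"
    using 1 by (simp only: mult_ac)
  then show ?thesis by (rule mult_right_le_imp_le) (use M0 in simp)
qed

lemma eventually_all_near_pairs_le:
  assumes "finite A" "\<And>l. l \<in> A \<Longrightarrow> near_pairs_bound \<alpha> x (f l)" "\<epsilon> > 0"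
  shows "\<forall>\<^sub>F N in sequentially. \<forall>l\<in>A.
    real (near_pairs x (f l / real N powr \<alpha>) N) \<le> (2 * f l + \<epsilon>) * real N powr (2 - \<alpha>)"
  using assms by (intro eventually_ball_finite) (auto simp: near_pairs_bound_def)

lemma sum_real_le_double: "2 * (\<Sum>l\<in>{1..n}. real l) = real n * (real n + 1)"
  by (induction n) (auto simp: algebra_simps)

lemma powr_two_minus: "N \<ge> 1 \<Longrightarrow> real N powr (2 - \<alpha>) = (real N)\<^sup>2 / real N powr \<alpha>"
  by (simp add: powr_diff)

text \<open>
  The sum of the pair counts at the scales \<open>l * s / q\<^sup>2\<close> is bounded below, and all its terms are
  bounded above, so none of them can be much smaller than its upper bound; the last \<open>q\<close> terms are
  compared with the count at scale \<open>s\<close>.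
\<close>

lemma near_pairs_lower:
  assumes "0 \<le> \<alpha>" "s > 0" "\<alpha> = 0 \<longrightarrow> s \<le> 1/2"
    and ub: "\<And>t. 0 < t \<Longrightarrow> t \<le> s \<Longrightarrow> near_pairs_bound \<alpha> x t"
    and "\<epsilon> > 0"
  shows "\<forall>\<^sub>F N in sequentially.
    (2 * s - \<epsilon>) * real N powr (2 - \<alpha>) \<le> real (near_pairs x (s / real N powr \<alpha>) N)"
proof -
  \<comment> \<open>The errors below come to at most \<open>2 * s + s\<^sup>2 + 1\<close>,
    independently of \<open>q\<close>, and are spread over the last \<open>q\<close> terms.\<close>
  obtain q :: nat where q: "(2 * s + s\<^sup>2 + 1) / \<epsilon> < real q" using reals_Archimedean2 by blast
  have q1: "real q > 0" using q assms by (smt (verit) divide_nonneg_pos zero_le_power2)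
  then have q1': "q \<ge> 1" by simp
  \<comment> \<open>With \<open>q\<^sup>2\<close> scales the last \<open>q\<close> of them lie
    between \<open>(1 - 1 / q) * s\<close> and \<open>s\<close>, so replacing them by
    \<open>s\<close> costs little.\<close>
  define L where "L = q\<^sup>2"
  have L1: "L \<ge> 1" using q1' by (simp add: L_def)
  have qL: "q \<le> L" by (simp add: L_def power2_eq_square)
  define t where "t l = real l * s / real L" for l
  have t0: "0 < t l" "t l \<le> s" if "l \<in> {1..L}" for l
    using that assms L1 by (auto simp: t_def field_simps)
  \<comment> \<open>This keeps the windows within half of the circle. At \<open>\<alpha> = 0\<close>
    the power is constantly \<open>1\<close>, and \<open>s \<le> 1/2\<close> ensures it.\<close>
  have ev2: "\<forall>\<^sub>F N in sequentially. 2 * s \<le> real N powr \<alpha> \<and> 1 \<le> real N powr \<alpha>"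
  proof (cases "\<alpha> = 0")
    case True
    show ?thesis using eventually_ge_at_top[of 1]
      by eventually_elim (use True assms in auto)
  next
    case False
    then show ?thesis
      using assms by (intro eventually_conj eventually_of_nat_powr_ge) auto
  qed
  \<comment> \<open>The tolerance \<open>1 / L\<close> lets the errors of all terms add up to at
    most \<open>1\<close>.\<close>
  have "\<forall>\<^sub>F N in sequentially. \<forall>l\<in>{1..L}.
      real (near_pairs x (t l / real N powr \<alpha>) N) \<le> (2 * t l + 1 / real L) * real N powr (2 - \<alpha>)"
    using t0 ub L1 by (intro eventually_all_near_pairs_le) auto
  with ev2 eventually_ge_at_top[of 1] show ?thesis
  proof eventually_elim
    case (elim N)
    let ?Z = "real N powr (2 - \<alpha>)"
    let ?P = "\<lambda>l. real (near_pairs x (t l / real N powr \<alpha>) N)"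
    let ?p = "real (near_pairs x (s / real N powr \<alpha>) N)"
    have Z: "?Z > 0" "?Z = (real N)\<^sup>2 / real N powr \<alpha>"
      using elim powr_two_minus[of N] by auto
    have "s\<^sup>2 / real N powr \<alpha> \<le> s\<^sup>2" using elim divide_left_mono[of 1 "real N powr \<alpha>" "s\<^sup>2"] by simp
    then have "(real L * s - s\<^sup>2) * ?Z \<le> (real L * s - s\<^sup>2 / real N powr \<alpha>) * ?Z"
      using Z by (intro mult_right_mono) auto
    also have "\<dots> \<le> (\<Sum>l\<in>{1..L}. ?P l)"
      using sum_near_pairs_lower[OF assms(2), of "real N powr \<alpha>" L N x] elim L1
      by (simp add: Z(2) t_def)
    also have "\<dots> = (\<Sum>l\<in>{1..L-q}. ?P l) + (\<Sum>l\<in>{L-q+1..L}. ?P l)"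
      using qL by (intro sum.ub_add_nat[of 1 "L - q" ?P q, simplified le_add_diff_inverse2[OF qL]]) simp
    also have "(\<Sum>l\<in>{L-q+1..L}. ?P l) \<le> (\<Sum>l\<in>{L-q+1..L}. ?p)"
    proof (intro sum_mono of_nat_mono near_pairs_mono divide_right_mono)
      fix l assume "l \<in> {L-q+1..L}"
      then show "t l \<le> s" by (intro t0) auto
    qed simp
    also have "(\<Sum>l\<in>{L-q+1..L}. ?p) = real q * ?p" using qL by simp
    also have "(\<Sum>l\<in>{1..L-q}. ?P l) \<le> (\<Sum>l\<in>{1..L-q}. (2 * t l + 1 / real L) * ?Z)"
      using elim by (intro sum_mono) auto
    also have "\<dots> = (\<Sum>l\<in>{1..L-q}. 2 * t l + 1 / real L) * ?Z" by (simp only: sum_distrib_right)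
    also have "(\<Sum>l\<in>{1..L-q}. 2 * t l + 1 / real L)
        = s / real L * (2 * (\<Sum>l\<in>{1..L-q}. real l)) + real (L - q) / real L"
      by (simp add: sum.distrib t_def sum_distrib_left mult_ac flip: sum_divide_distrib)
    also have "\<dots> = s / real L * ((real L - real q) * (real L - real q + 1)) + (real L - real q) / real L"
      using qL by (simp only: sum_real_le_double of_nat_diff)
    also have "\<dots> \<le> s * ((real q - 1)\<^sup>2 + 1) + 1"
    proof -
      have "s / real L * ((real L - real q) * (real L - real q + 1)) = s * ((real q - 1)\<^sup>2 + (real q - 1) / real q)"
        using q1 by (simp add: L_def field_simps power2_eq_square)
      moreover have "(real q - 1) / real q \<le> 1" "(real L - real q) / real L \<le> 1"
        using q1 L1 by auto
      ultimately show ?thesis using assms(2) by (intro add_mono) auto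
    qed
    finally have "(real L * s - s\<^sup>2) * ?Z \<le> (s * ((real q - 1)\<^sup>2 + 1) + 1) * ?Z + real q * ?p"
      using Z(1) by simp
    then have "(real L * s - s\<^sup>2 - (s * ((real q - 1)\<^sup>2 + 1) + 1)) * ?Z \<le> real q * ?p"
      by (simp add: algebra_simps)
    also have "real L * s - s\<^sup>2 - (s * ((real q - 1)\<^sup>2 + 1) + 1) = real q * (2 * s) - (2 * s + s\<^sup>2 + 1)"
      by (simp add: L_def power2_eq_square algebra_simps)
    finally have a: "(real q * (2 * s) - (2 * s + s\<^sup>2 + 1)) * ?Z \<le> real q * ?p" .
    have "2 * s + s\<^sup>2 + 1 \<le> real q * \<epsilon>" using q assms by (simp add: divide_less_eq less_imp_le)
    then have "(real q * (2 * s) - real q * \<epsilon>) * ?Z \<le> (real q * (2 * s) - (2 * s + s\<^sup>2 + 1)) * ?Z"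
      using Z by (intro mult_right_mono) auto
    with a have "real q * ((2 * s - \<epsilon>) * ?Z) \<le> real q * ?p" by (simp add: algebra_simps)
    then show ?case using q1 by simp
  qed
qed

text \<open>Upper bounds at all scales up to \<open>s\<close> suffice, since
  \<open>near_pairs_lower\<close> derives the matching lower bound from them.\<close>

lemma pair_corr_tendsto:
  assumes "0 \<le> \<alpha>" "\<alpha> < 1" "s > 0" "\<alpha> = 0 \<longrightarrow> s \<le> 1/2"
    and ub: "\<And>t. 0 < t \<Longrightarrow> t \<le> s \<Longrightarrow> near_pairs_bound \<alpha> x t"
  shows "(\<lambda>N. pair_corr \<alpha> x s N) \<longlonglongrightarrow> 2 * s"
proof -
  let ?f = "\<lambda>N. real (near_pairs x (s / real N powr \<alpha>) N) / real N powr (2 - \<alpha>)"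
  have "?f \<longlonglongrightarrow> 2 * s"
  proof (rule tendstoI)
    fix e :: real assume e: "e > 0"
    have "\<forall>\<^sub>F N in sequentially.
        real (near_pairs x (s / real N powr \<alpha>) N) \<le> (2 * s + e / 2) * real N powr (2 - \<alpha>)"
      using ub[of s] assms e unfolding near_pairs_bound_def by simp
    moreover have "\<forall>\<^sub>F N in sequentially.
        (2 * s - e / 2) * real N powr (2 - \<alpha>) \<le> real (near_pairs x (s / real N powr \<alpha>) N)"
      using assms e by (intro near_pairs_lower) auto
    ultimately show "\<forall>\<^sub>F N in sequentially. dist (?f N) (2 * s) < e"
      using eventually_ge_at_top[of 1]
    proof eventually_elim
      case (elim N)
      then have "?f N \<le> 2 * s + e / 2" "2 * s - e / 2 \<le> ?f N"
        by (simp_all add: pos_divide_le_eq pos_le_divide_eq)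
      then show ?case using e unfolding dist_real_def by linarith
    qed
  qed
  moreover have "(\<lambda>N. real N powr (\<alpha> - 1)) \<longlonglongrightarrow> 0"
    using assms by (intro tendsto_of_nat_powr_neg) simp
  ultimately have "(\<lambda>N. ?f N - real N powr (\<alpha> - 1)) \<longlonglongrightarrow> 2 * s - 0"
    by (rule tendsto_diff)
  moreover have "\<forall>\<^sub>F N in sequentially. ?f N - real N powr (\<alpha> - 1) = pair_corr \<alpha> x s N"
    using eventually_ge_at_top[of 1]
    by eventually_elim (use near_pairs_eq_pair_corr[of s _ x \<alpha>] assms in simp)
  ultimately show ?thesis by (simp add: tendsto_cong)
qed

section \<open>Passing to coarser scales\<close>

lemma PPC_imp_near_pairs_bound:
  assumes "PPC \<alpha> x" "\<alpha> < 1" "t > 0" "\<alpha> = 0 \<longrightarrow> t \<le> 1/2"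
  shows "near_pairs_bound \<alpha> x t"
proof (rule near_pairs_boundI)
  fix \<epsilon> :: real assume "\<epsilon> > 0"
  have "(\<lambda>N. pair_corr \<alpha> x t N) \<longlonglongrightarrow> 2 * t" using assms by (simp add: PPC_def)
  then have "\<forall>\<^sub>F N in sequentially. pair_corr \<alpha> x t N < 2 * t + \<epsilon>"
    by (rule order_tendstoD) (use \<open>\<epsilon> > 0\<close> in simp)
  then show "\<forall>\<^sub>F N in sequentially. pair_corr \<alpha> x t N \<le> 2 * t + \<epsilon>"
    by eventually_elim simp
qed (use assms in auto)

text \<open>The second moment of windows of length about \<open>1 / real N powr \<beta>\<close> is
  bounded by the finer pair counts, and in turn bounds the pairs within
  \<open>s / real N powr \<alpha>\<close>. Windows are short against this distance, so what is lost
  is of relative order \<open>1 / L\<close> in the limit.\<close>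

lemma near_pairs_bound_coarser:
  assumes "0 \<le> \<alpha>" "\<alpha> < \<beta>" "s > 0"
    and ub: "\<And>t. 0 < t \<Longrightarrow> near_pairs_bound \<beta> x t"
  shows "near_pairs_bound \<alpha> x s"
  unfolding near_pairs_bound_def
proof (intro allI impI)
  fix \<epsilon> :: real assume \<epsilon>: "\<epsilon> > 0"
  \<comment> \<open>The bound on the second moment carries a factor \<open>1 + 2 / L\<close>, so the
    limit of \<open>err\<close> is \<open>2 * s + 4 * s / L\<close>.\<close>
  obtain L :: nat where L: "4 * s / \<epsilon> < real L" using reals_Archimedean2 by blast
  have L0: "real L > 0" using L assms \<epsilon> by (smt (verit) divide_nonneg_pos)
  then have L1: "L \<ge> 1" by simp
  \<comment> \<open>The product of the bounds for \<open>2 * H + 1\<close> and for the second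
    moment, divided by \<open>(real L)\<^sup>2\<close> and by
    \<open>real N powr (2 - \<alpha>)\<close>. The negative powers of \<open>N\<close> come from
    rounding and from the window length.\<close>
  define err where "err N = (2 * real L * s + 2 * s * real N powr (- \<beta>) + (2 * real L + 3) * real N powr (\<alpha> - \<beta>))
      * (real L + 2) / (real L)\<^sup>2" for N
  have "err \<longlonglongrightarrow> (2 * real L * s + 2 * s * 0 + (2 * real L + 3) * 0) * (real L + 2) / (real L)\<^sup>2"
    unfolding err_def using assms L0
    by (intro tendsto_intros tendsto_of_nat_powr_neg) auto
  also have "(2 * real L * s + 2 * s * 0 + (2 * real L + 3) * 0) * (real L + 2) / (real L)\<^sup>2
      = 2 * s + 4 * s / real L"
    using L0 by (simp add: field_simps power2_eq_square)
  finally have "err \<longlonglongrightarrow> 2 * s + 4 * s / real L" .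
  moreover have "2 * s + 4 * s / real L < 2 * s + \<epsilon>" using L L0 \<epsilon> by (simp add: field_simps)
  ultimately have ev_err: "\<forall>\<^sub>F N in sequentially. err N < 2 * s + \<epsilon>" by (rule order_tendstoD)
  have ev2: "\<forall>\<^sub>F N in sequentially. 2 \<le> real N powr \<beta>"
    using assms by (intro eventually_of_nat_powr_ge) simp
  have "\<forall>\<^sub>F N in sequentially. \<forall>l\<in>{1..L}. real (near_pairs x ((real l / real L) / real N powr \<beta>) N)
      \<le> (2 * (real l / real L) + 1 / real L) * real N powr (2 - \<beta>)"
    using ub L0 by (intro eventually_all_near_pairs_le) auto
  with ev_err ev2 eventually_ge_at_top[of 1]
  show "\<forall>\<^sub>F N in sequentially. real (near_pairs x (s / real N powr \<alpha>) N) \<le> (2 * s + \<epsilon>) * real N powr (2 - \<alpha>)"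
  proof eventually_elim
    case (elim N)
    define M where "M = nat \<lceil>real L * real N powr \<beta>\<rceil>"
    define r where "r = s / real N powr \<alpha>"
    define H where "H = nat \<lceil>real M * r\<rceil> + L"
    have N0: "real N > 0" using elim by simp
    have r0: "r > 0" using assms N0 by (simp add: r_def)
    have M: "real L * real N powr \<beta> \<le> real M" "real M \<le> real L * real N powr \<beta> + 1"
      unfolding M_def
    proof -
      have "0 \<le> real L * real N powr \<beta>" by simp
      then show "real (nat \<lceil>real L * real N powr \<beta>\<rceil>) \<le> real L * real N powr \<beta> + 1" by linarith
    qed (rule real_nat_ceiling_ge)
    have "2 * real L \<le> real L * real N powr \<beta>"
      using elim L0 by (simp add: mult.commute)
    then have M2: "2 * L \<le> M" using M(1) by linarith
    have M0: "M > 0" using M2 L1 by linarith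
    have Mr: "real M * r \<ge> 0" using r0 by simp
    have H: "real M * r + real L \<le> real H" "real H \<le> real M * r + 1 + real L"
      unfolding H_def using Mr by linarith+
    let ?S = "\<Sum>c\<in>{0..<int M}. (real (window M L x N c))\<^sup>2"
    let ?B = "(real L + 2) * real N powr (2 - \<beta>)"
    have "?S \<le> (\<Sum>l\<in>{1..L}. real (near_pairs x (real l / real M) N))"
      by (rule sum_window_sq_le[OF M0 M2])
    also have "\<dots> \<le> (\<Sum>l\<in>{1..L}. real (near_pairs x ((real l / real L) / real N powr \<beta>) N))"
    proof (intro sum_mono of_nat_mono near_pairs_mono)
      fix l assume "l \<in> {1..L}"
      have "real l / real M \<le> real l / (real L * real N powr \<beta>)"
        using M(1) M0 L0 N0 by (intro divide_left_mono) auto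
      then show "real l / real M \<le> (real l / real L) / real N powr \<beta>" by simp
    qed
    also have "\<dots> \<le> (\<Sum>l\<in>{1..L}. (2 * (real l / real L) + 1 / real L) * real N powr (2 - \<beta>))"
      using elim by (intro sum_mono) auto
    also have "\<dots> = (\<Sum>l\<in>{1..L}. 2 * (real l / real L) + 1 / real L) * real N powr (2 - \<beta>)"
      by (simp only: sum_distrib_right)
    also have "(\<Sum>l\<in>{1..L}. 2 * (real l / real L) + 1 / real L) = (2 * (\<Sum>l\<in>{1..L}. real l)) / real L + 1"
      using L0 by (simp add: sum.distrib sum_distrib_left flip: sum_divide_distrib)
    also have "\<dots> = real L + 2" unfolding sum_real_le_double using L0 by simp
    finally have S: "?S \<le> ?B" .
    have "2 * real H + 1 \<le> 2 * (real L * real N powr \<beta> + 1) * r + 2 * real L + 3"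
    proof -
      have "real M * r \<le> (real L * real N powr \<beta> + 1) * r" using M(2) r0 by (intro mult_right_mono) auto
      then show ?thesis using H(2) by linarith
    qed
    also have "\<dots> = (2 * real L * s + 2 * s * real N powr (- \<beta>) + (2 * real L + 3) * real N powr (\<alpha> - \<beta>)) * real N powr (\<beta> - \<alpha>)"
      using N0 by (simp add: r_def powr_diff powr_minus field_simps)
    finally have H': "2 * real H + 1 \<le> \<dots>" .
    have "(real L)\<^sup>2 * real (near_pairs x r N) \<le> (2 * real H + 1) * ?S"
      by (rule near_pairs_le_sum_window_sq) (use M0 M2 H in auto)
    also have "\<dots> \<le> (2 * real H + 1) * ?B" using S by (intro mult_left_mono) auto
    also have "\<dots> \<le> (2 * real L * s + 2 * s * real N powr (- \<beta>) + (2 * real L + 3) * real N powr (\<alpha> - \<beta>)) * real N powr (\<beta> - \<alpha>) * ?B"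
      by (rule mult_right_mono[OF H']) simp
    also have "\<dots> = (real L)\<^sup>2 * (err N * (real N powr (\<beta> - \<alpha>) * real N powr (2 - \<beta>)))"
      unfolding err_def using L0 by (simp add: field_simps)
    also have "real N powr (\<beta> - \<alpha>) * real N powr (2 - \<beta>) = real N powr (2 - \<alpha>)"
      by (simp flip: powr_add)
    finally have "real (near_pairs x r N) \<le> err N * real N powr (2 - \<alpha>)" using L0 by simp
    also have "\<dots> \<le> (2 * s + \<epsilon>) * real N powr (2 - \<alpha>)" using elim by (intro mult_right_mono) auto
    finally show ?case unfolding r_def .
  qed
qed

lemma PPC_coarser:
  assumes "PPC \<beta> x" "0 \<le> \<alpha>" "\<alpha> \<le> \<beta>" "\<beta> < 1"
  shows "PPC \<alpha> x"
proof (cases "\<alpha> = \<beta>")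
  case False
  then have "near_pairs_bound \<alpha> x t" if "t > 0" for t
    using assms that by (intro near_pairs_bound_coarser[of \<alpha> \<beta>] PPC_imp_near_pairs_bound) auto
  then show ?thesis
    unfolding PPC_def using assms by (intro allI impI pair_corr_tendsto) auto
qed (use assms in simp)

section \<open>Uniform distribution from pair correlations at scale zero\<close>

text \<open>The second moment of the window counts asymptotically exceeds the square of their mean
  by no more than a discretisation error. So their variance is small, and Cauchy-Schwarz over the
  windows meeting the interval bounds the total there.\<close>

lemma interval_count_le:
  assumes "PPC 0 x" "a \<le> b" "\<epsilon> > 0"
  shows "\<forall>\<^sub>F N in sequentially. real (card {i \<in> {1..N}. x i \<in> {a..b}}) \<le> (b - a + \<epsilon>) * real N"
proof -
  obtain q :: nat where q: "2 / \<epsilon> < real q" using reals_Archimedean2 by blast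
  have q0: "real q > 0" using q assms by (smt (verit) divide_pos_pos)
  \<comment> \<open>Windows have length \<open>1 / (2 * q)\<close>, so the edge error is at most
    \<open>N / q\<close>. With \<open>L = 2 * q\<^sup>2\<close> the deviation
    \<open>2 * q * N\<close>, divided by \<open>L\<close>, is another \<open>N / q\<close>.\<close>
  define L where "L = 2 * q\<^sup>2"
  define M where "M = 2 * q * L"
  have L0: "real L > 0" using q0 by (simp add: L_def)
  have M0: "M > 0" and M2: "2 * L \<le> M" using q0 by (auto simp: M_def L_def)
  have "near_pairs_bound 0 x (real l / real M)" if "l \<in> {1..L}" for l
  proof (rule PPC_imp_near_pairs_bound[OF assms(1)])
    have "2 * real l \<le> real M" using that M2 by auto
    then show "0 = 0 \<longrightarrow> real l / real M \<le> 1/2" "0 < real l / real M"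
      using M0 that by (simp_all add: field_simps)
  qed simp
  then have "\<forall>\<^sub>F N in sequentially. \<forall>l\<in>{1..L}. real (near_pairs x ((real l / real M) / real N powr 0) N)
      \<le> (2 * (real l / real M) + 1 / real M) * real N powr (2 - 0)"
    using M0 by (intro eventually_all_near_pairs_le) auto
  with eventually_ge_at_top[of 1] show ?thesis
  proof eventually_elim
    case (elim N)
    have N0: "real N > 0" using elim by simp
    let ?W = "\<lambda>c. real (window M L x N c)" and ?C = "{0..<int M}"
    let ?w = "real L * real N / real M"
    have "(\<Sum>c\<in>?C. (?W c)\<^sup>2) \<le> (\<Sum>l\<in>{1..L}. real (near_pairs x (real l / real M) N))"
      by (rule sum_window_sq_le[OF M0 M2])
    also have "\<dots> \<le> (\<Sum>l\<in>{1..L}. (2 * (real l / real M) + 1 / real M) * (real N)\<^sup>2)"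
      using elim by (intro sum_mono) (auto simp: powr_numeral)
    also have "\<dots> = (\<Sum>l\<in>{1..L}. 2 * (real l / real M) + 1 / real M) * (real N)\<^sup>2"
      by (simp only: sum_distrib_right)
    also have "(\<Sum>l\<in>{1..L}. 2 * (real l / real M) + 1 / real M)
        = (2 * (\<Sum>l\<in>{1..L}. real l)) / real M + real L / real M"
      by (simp add: sum.distrib sum_distrib_left flip: sum_divide_distrib)
    also have "\<dots> = ((real L)\<^sup>2 + 2 * real L) / real M"
      unfolding sum_real_le_double by (simp add: power2_eq_square algebra_simps add_divide_distrib)
    finally have sq: "(\<Sum>c\<in>?C. (?W c)\<^sup>2) \<le> ((real L)\<^sup>2 + 2 * real L) / real M * (real N)\<^sup>2" .
    \<comment> \<open>The mean count is \<open>?w\<close>; its square cancels the leading part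
      \<open>(real L)\<^sup>2 / real M\<close> of the second moment.\<close>
    have "(\<Sum>c\<in>?C. (?W c - ?w)\<^sup>2) = (\<Sum>c\<in>?C. (?W c)\<^sup>2) - 2 * ?w * (\<Sum>c\<in>?C. ?W c) + real M * ?w\<^sup>2"
      by (simp add: power2_diff sum.distrib sum_subtractf sum_distrib_left mult_ac)
    also have "\<dots> = (\<Sum>c\<in>?C. (?W c)\<^sup>2) - (real L)\<^sup>2 / real M * (real N)\<^sup>2"
      using M0 M2 by (subst sum_window) (auto simp: field_simps power2_eq_square)
    also have "\<dots> \<le> 2 * real L / real M * (real N)\<^sup>2"
      using sq by (simp add: add_divide_distrib distrib_right)
    finally have V: "(\<Sum>c\<in>?C. (?W c - ?w)\<^sup>2) \<le> 2 * real L / real M * (real N)\<^sup>2" .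
    obtain S where S: "S \<subseteq> ?C" "real (card S) \<le> real M * (b - a) + real L + 1"
      "real L * real (card {i \<in> {1..N}. x i \<in> {a..b}}) \<le> (\<Sum>c\<in>S. ?W c)"
      using M0 M2 assms(2) by (elim card_interval_le_sum_window[of M L a b N x, rotated 3]) auto
    have finS: "finite S" using S(1) by (rule finite_subset) simp
    have "card S \<le> M" using card_mono[OF _ S(1)] by simp
    have "(\<Sum>c\<in>S. ?W c - ?w)\<^sup>2 \<le> (\<Sum>c\<in>S. (?W c - ?w)\<^sup>2) * real (card S)"
      by (rule sum_squared_le_sum_of_squares)
    also have "\<dots> \<le> (2 * real L / real M * (real N)\<^sup>2) * real M"
    proof (rule mult_mono)
      have "(\<Sum>c\<in>S. (?W c - ?w)\<^sup>2) \<le> (\<Sum>c\<in>?C. (?W c - ?w)\<^sup>2)"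
        using S(1) by (intro sum_mono2) auto
      then show "(\<Sum>c\<in>S. (?W c - ?w)\<^sup>2) \<le> 2 * real L / real M * (real N)\<^sup>2" using V by simp
    qed (use \<open>card S \<le> M\<close> in auto)
    also have "\<dots> = (2 * real q * real N)\<^sup>2" using M0 by (simp add: L_def power_mult_distrib)
    finally have "(\<Sum>c\<in>S. ?W c - ?w) \<le> 2 * real q * real N" by (rule power2_le_imp_le) simp
    then have "(\<Sum>c\<in>S. ?W c) \<le> real (card S) * ?w + 2 * real q * real N"
      by (simp add: sum_subtractf)
    also have "\<dots> \<le> (real M * (b - a) + real L + 1) * ?w + 2 * real q * real N"
      using S(2) by (intro add_right_mono mult_right_mono) auto
    also have "\<dots> \<le> (real M * (b - a) + 2 * real L) * ?w + 2 * real q * real N"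
      using L0 by (intro add_right_mono mult_right_mono) auto
    also have "\<dots> = real L * ((b - a + 2 / real q) * real N)"
      using q0 by (simp add: M_def L_def field_simps power2_eq_square)
    finally have "real (card {i \<in> {1..N}. x i \<in> {a..b}}) \<le> (b - a + 2 / real q) * real N"
      using S(3) L0 by (smt (verit) mult_left_le_imp_le)
    also have "\<dots> \<le> (b - a + \<epsilon>) * real N"
      using q q0 assms by (intro mult_right_mono) (auto simp: field_simps)
    finally show ?case .
  qed
qed

text \<open>The lower bound follows from upper bounds for the two remaining intervals, because
  \<open>{0..a}\<close>, \<open>{a..b}\<close> and \<open>{b..1}\<close> cover all points.\<close>

lemma PPC_0_imp_uniformly_distributed:
  assumes "PPC 0 x" and x01: "\<And>n. n \<ge> 1 \<Longrightarrow> x n \<in> {0..1}"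
  shows "uniformly_distributed x"
  unfolding uniformly_distributed_def
proof (intro allI impI)
  fix a b :: real assume ab: "0 \<le> a" "a < b" "b \<le> 1"
  let ?A = "\<lambda>a b N. {i \<in> {1..N}. x i \<in> {a..b}}"
  show "(\<lambda>N. real (card (?A a b N)) / real N) \<longlonglongrightarrow> b - a"
  proof (rule tendstoI)
    fix e :: real assume e: "e > 0"
    have "\<forall>\<^sub>F N in sequentially. real (card (?A a b N)) \<le> (b - a + e / 3) * real N"
      "\<forall>\<^sub>F N in sequentially. real (card (?A 0 a N)) \<le> (a - 0 + e / 3) * real N"
      "\<forall>\<^sub>F N in sequentially. real (card (?A b 1 N)) \<le> (1 - b + e / 3) * real N"
      using ab e by (intro interval_count_le[OF assms(1)]; simp)+
    then show "\<forall>\<^sub>F N in sequentially. dist (real (card (?A a b N)) / real N) (b - a) < e"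
      using eventually_ge_at_top[of 1]
    proof eventually_elim
      case (elim N)
      have "{1..N} \<subseteq> (?A 0 a N \<union> ?A a b N) \<union> ?A b 1 N" using x01 by fastforce
      then have "card {1..N} \<le> card ((?A 0 a N \<union> ?A a b N) \<union> ?A b 1 N)" by (intro card_mono) auto
      also have "\<dots> \<le> card (?A 0 a N) + card (?A a b N) + card (?A b 1 N)"
        using card_Un_le[of "?A 0 a N \<union> ?A a b N" "?A b 1 N"] card_Un_le[of "?A 0 a N" "?A a b N"]
        by linarith
      finally have "N \<le> card (?A 0 a N) + card (?A a b N) + card (?A b 1 N)" by simp
      then have "(b - a - 2 * (e / 3)) * real N \<le> real (card (?A a b N))"
        using elim by (simp add: algebra_simps)
      with elim have "b - a - 2 * (e / 3) \<le> real (card (?A a b N)) / real N"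
        "real (card (?A a b N)) / real N \<le> b - a + e / 3"
        by (simp_all add: pos_divide_le_eq pos_le_divide_eq)
      then show ?case using e unfolding dist_real_def by linarith
    qed
  qed
qed

subsection \<open>Reducing the order of correlation\<close>

text \<open>Quantitative convexity: non-negativity of the gap gives Jensen's inequality, and its
  size controls the equality case.\<close>

lemma power_tangent_gap:
  fixes t c :: real
  assumes "t \<ge> 0" "c > 0" "p \<ge> 2"
  shows "\<bar>t - c\<bar> ^ p \<le> t ^ p - c ^ p - real p * c ^ (p - 1) * (t - c)"
  using assms(3)
proof (induction p rule: dec_induct)
  case base
  show ?case by (simp add: power2_eq_square algebra_simps)
next
  case (step p)
  define G where "G = t ^ p - c ^ p - real p * c ^ (p - 1) * (t - c)"
  have IH: "\<bar>t - c\<bar> ^ p \<le> G" using step.IH by (simp add: G_def)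
  have cp: "c ^ p = c * c ^ (p - 1)" using step.hyps by (cases p) auto
  \<comment> \<open>Both terms of this recursion are non-negative. For \<open>t \<ge> c\<close> the
    first suffices, as \<open>\<bar>t - c\<bar> \<le> t\<close>; for \<open>t < c\<close> the second
    does, as \<open>\<bar>t - c\<bar> \<le> c\<close>.\<close>
  have rec: "t ^ Suc p - c ^ Suc p - real (Suc p) * c ^ (Suc p - 1) * (t - c)
      = t * G + real p * c ^ (p - 1) * (t - c)\<^sup>2"
    unfolding G_def by (simp add: cp power2_eq_square algebra_simps)
  have "\<bar>t - c\<bar> * \<bar>t - c\<bar> ^ p \<le> t * G + real p * c ^ (p - 1) * (t - c)\<^sup>2"
  proof (cases "c \<le> t")
    case True
    then have "\<bar>t - c\<bar> * \<bar>t - c\<bar> ^ p \<le> t * G"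
      using IH assms by (intro mult_mono) auto
    moreover have "0 \<le> real p * c ^ (p - 1) * (t - c)\<^sup>2" using assms by simp
    ultimately show ?thesis by linarith
  next
    case False
    have "\<bar>t - c\<bar> * \<bar>t - c\<bar> ^ p = \<bar>t - c\<bar> ^ (p - 1) * (t - c)\<^sup>2"
      using step.hyps by (cases p) (auto simp: power2_eq_square abs_if algebra_simps)
    also have "\<dots> \<le> c ^ (p - 1) * (t - c)\<^sup>2"
      using False assms by (intro mult_right_mono power_mono) auto
    also have "\<dots> \<le> real p * c ^ (p - 1) * (t - c)\<^sup>2"
      using step.hyps assms by (intro mult_right_mono) auto
    also have "\<dots> \<le> t * G + real p * c ^ (p - 1) * (t - c)\<^sup>2"
    proof -
      have "0 \<le> \<bar>t - c\<bar> ^ p" by simp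
      then have "0 \<le> G" using IH by linarith
      then show ?thesis using assms by simp
    qed
    finally show ?thesis .
  qed
  then show ?case unfolding rec by simp
qed

lemma power_add_le:
  fixes a b :: real
  assumes "a \<ge> 0" "b \<ge> 0"
  shows "(a + b) ^ p \<le> 2 ^ p * (a ^ p + b ^ p)"
proof -
  have "(a + b) ^ p \<le> (2 * max a b) ^ p" using assms by (intro power_mono) auto
  also have "\<dots> = 2 ^ p * max a b ^ p" by (simp add: power_mult_distrib)
  also have "max a b ^ p \<le> a ^ p + b ^ p" using assms by (auto simp: max_def)
  finally show ?thesis by simp
qed

text \<open>Young's inequality with crude constants: both rescaled factors are at most their
  maximum. A small \<open>\<eta>\<close> shrinks the \<open>Q\<close> term at the price of a large
  constant at the \<open>D\<close> term.\<close>

lemma mult_power_le_scaled: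
  fixes D Q \<eta> :: real
  assumes "D \<ge> 0" "Q \<ge> 0" "\<eta> > 0" "p \<ge> 1"
  shows "D * Q ^ (p - 1) \<le> D ^ p / (\<eta> ^ (p - 1)) ^ p + \<eta> ^ p * Q ^ p"
proof -
  let ?u = "D / \<eta> ^ (p - 1)" and ?v = "\<eta> * Q"
  have uv: "?u \<ge> 0" "?v \<ge> 0" using assms by auto
  have "D * Q ^ (p - 1) = ?u * ?v ^ (p - 1)" using assms by (simp add: power_mult_distrib)
  also have "\<dots> \<le> max ?u ?v * max ?u ?v ^ (p - 1)"
    using uv by (intro mult_mono power_mono) auto
  also have "\<dots> = max ?u ?v ^ p" using assms by (cases p) auto
  also have "\<dots> \<le> ?u ^ p + ?v ^ p" using uv by (auto simp: max_def)
  finally show ?thesis by (simp add: power_divide power_mult_distrib)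
qed

section \<open>Moments of the numbers of neighbours\<close>

text \<open>The normalisation is \<open>N\<close> for the first index and one factor
  \<open>real N powr (1 - \<beta>)\<close>, the order of the mean number of neighbours, for each
  further index.\<close>

lemma powr_corr_exponent:
  assumes "N \<ge> 1" "m \<ge> 1"
  shows "real N powr (real m - (real m - 1) * \<beta>) = real N * (real N powr (1 - \<beta>)) ^ (m - 1)"
proof -
  have "(real N powr (1 - \<beta>)) ^ (m - 1) = real N powr ((1 - \<beta>) * real (m - 1))"
    using assms by (simp add: powr_powr flip: powr_realpow)
  moreover have "real m - (real m - 1) * \<beta> = 1 + (1 - \<beta>) * real (m - 1)"
    using assms by (simp add: of_nat_diff algebra_simps)
  ultimately show ?thesis using assms by (simp add: powr_add)
qed

lemma pair_corr_eq_sum_neighbours: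
  assumes "N \<ge> 1"
  shows "pair_corr \<beta> x s N
       = (\<Sum>n\<in>{1..N}. real (card (neighbours \<beta> x (- s) s N n)) / real N powr (1 - \<beta>)) / real N"
proof -
  have "{(m, n). m \<in> {1..N} \<and> n \<in> {1..N} \<and> m \<noteq> n \<and> dist_int (x m - x n) \<le> s / real N powr \<beta>}
      = Sigma {1..N} (neighbours \<beta> x (- s) s N)"
    using assms by (auto simp: neighbours_def dist_int_eq_abs_signed_res abs_le_iff field_simps)
  then have "pair_corr \<beta> x s N = (\<Sum>n\<in>{1..N}. real (card (neighbours \<beta> x (- s) s N n))) / real N powr (2 - \<beta>)"
    unfolding pair_corr_def by simp
  moreover have "real N powr (2 - \<beta>) = real N powr (1 - \<beta>) * real N"
    using assms powr_add[of "real N" "1 - \<beta>" 1] by simp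
  ultimately show ?thesis by (simp flip: sum_divide_distrib)
qed

text \<open>
  Subtracting \<open>p\<close> turns the falling factorial that counts tuples of distinct neighbours into a power.
\<close>

definition excess :: "nat \<Rightarrow> real \<Rightarrow> (nat \<Rightarrow> real) \<Rightarrow> real \<Rightarrow> nat \<Rightarrow> nat \<Rightarrow> real" where
  "excess p \<beta> x s N n = max 0 (real (card (neighbours \<beta> x (- s) s N n)) - real p) / real N powr (1 - \<beta>)"

lemma excess_nonneg: "excess p \<beta> x s N n \<ge> 0"
  by (simp add: excess_def)

lemma excess_le: "excess p \<beta> x s N n \<le> real (card (neighbours \<beta> x (- s) s N n)) / real N powr (1 - \<beta>)"
  unfolding excess_def by (rule divide_right_mono) auto

lemma le_excess:
  "real (card (neighbours \<beta> x (- s) s N n)) / real N powr (1 - \<beta>)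
     \<le> excess p \<beta> x s N n + real p / real N powr (1 - \<beta>)"
  unfolding excess_def add_divide_distrib[symmetric] by (rule divide_right_mono) auto

lemma sum_excess_power_le_corr:
  assumes "N \<ge> 1"
  shows "(\<Sum>n\<in>{1..N}. excess p \<beta> x s N n ^ p) / real N
       \<le> corr (Suc p) \<beta> x (rectangle p (\<lambda>_. - s) (\<lambda>_. s)) N"
proof -
  let ?\<Theta> = "real N powr (1 - \<beta>)"
  have "(\<Sum>n\<in>{1..N}. excess p \<beta> x s N n ^ p) / real N
      = (\<Sum>n\<in>{1..N}. max 0 (real (card (neighbours \<beta> x (- s) s N n)) - real p) ^ p) / (real N * ?\<Theta> ^ p)"
    unfolding excess_def by (simp add: power_divide mult.commute flip: sum_divide_distrib)
  also have "\<dots> \<le> real (card (tuples (Suc p) \<beta> x (\<lambda>_. - s) (\<lambda>_. s) N)) / (real N * ?\<Theta> ^ p)"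
    using sum_tuples_lower[of "Suc p" p N "\<lambda>_. 1" \<beta> x "- s" s] by (intro divide_right_mono) auto
  also have "\<dots> = corr (Suc p) \<beta> x (rectangle p (\<lambda>_. - s) (\<lambda>_. s)) N"
    using corr_rectangle[of "Suc p" \<beta> x "\<lambda>_. - s" "\<lambda>_. s" N]
      powr_corr_exponent[OF assms, of "Suc p" \<beta>] by simp
  finally show ?thesis .
qed

lemma poissonian_corr_cube:
  assumes "poissonian_correlations (Suc p) \<beta> x" "s > 0" "\<beta> = 0 \<longrightarrow> s \<le> 1/2"
  shows "corr (Suc p) \<beta> x (rectangle p (\<lambda>_. - s) (\<lambda>_. s)) \<longlonglongrightarrow> (2 * s) ^ p"
proof -
  have "rectangle p (\<lambda>_. - s) (\<lambda>_. s) \<subseteq> rectangle p (\<lambda>_. - (1/2)) (\<lambda>_. 1/2)" if "\<beta> = 0"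
    unfolding rectangle_def using assms that by (intro PiE_mono) auto
  then have "corr (Suc p) \<beta> x (rectangle p (\<lambda>_. - s) (\<lambda>_. s))
      \<longlonglongrightarrow> measure (lebesgue_space p) (rectangle p (\<lambda>_. - s) (\<lambda>_. s))"
    using assms unfolding poissonian_correlations_def by simp
  also have "measure (lebesgue_space p) (rectangle p (\<lambda>_. - s) (\<lambda>_. s)) = (2 * s) ^ p"
    using assms by (subst measure_rectangle) auto
  finally show ?thesis .
qed

text \<open>Jensen's inequality for the \<open>p\<close>-th power, in the form of the tangent inequality at \<open>2 * s\<close>.\<close>

lemma poissonian_imp_near_pairs_bound:
  assumes pc: "poissonian_correlations (Suc p) \<beta> x" and p: "p \<ge> 2" and \<beta>: "\<beta> < 1"
    and s: "s > 0" "\<beta> = 0 \<longrightarrow> s \<le> 1/2"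
  shows "near_pairs_bound \<beta> x s"
proof (rule near_pairs_boundI)
  fix \<epsilon> :: real assume \<epsilon>: "\<epsilon> > 0"
  let ?c = "2 * s"
  define R where "R = corr (Suc p) \<beta> x (rectangle p (\<lambda>_. - s) (\<lambda>_. s))"
  define K where "K = real p * ?c ^ (p - 1)"
  have K: "K > 0" using p s by (simp add: K_def)
  \<comment> \<open>The averaged tangent inequality, solved for the first moment; the last term
    restores the \<open>p\<close> subtracted in \<open>excess\<close>.\<close>
  define U where "U N = ?c + (R N - ?c ^ p) / K + real p * real N powr (\<beta> - 1)" for N
  have "R \<longlonglongrightarrow> ?c ^ p" unfolding R_def by (rule poissonian_corr_cube[OF pc s])
  then have "U \<longlonglongrightarrow> ?c + (?c ^ p - ?c ^ p) / K + real p * 0"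
    unfolding U_def using \<beta> K by (intro tendsto_intros tendsto_of_nat_powr_neg) auto
  then have "\<forall>\<^sub>F N in sequentially. U N < ?c + \<epsilon>"
    by (rule order_tendstoD) (use \<epsilon> in simp)
  with eventually_ge_at_top[of 1]
  show "\<forall>\<^sub>F N in sequentially. pair_corr \<beta> x s N \<le> 2 * s + \<epsilon>"
  proof eventually_elim
    case (elim N)
    let ?E = "\<lambda>n. excess p \<beta> x s N n"
    let ?q = "real p / real N powr (1 - \<beta>)"
    have N0: "real N > 0" using elim by simp
    have "pair_corr \<beta> x s N \<le> (\<Sum>n\<in>{1..N}. ?E n + ?q) / real N"
      unfolding pair_corr_eq_sum_neighbours[OF elim(1)]
      by (intro divide_right_mono sum_mono le_excess) simp
    also have "(\<Sum>n\<in>{1..N}. ?E n + ?q) \<le> (\<Sum>n\<in>{1..N}. ?c + (?E n ^ p - ?c ^ p) / K + ?q)"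
    proof (intro sum_mono add_right_mono)
      fix n
      have "0 \<le> \<bar>?E n - ?c\<bar> ^ p" by simp
      also have "\<dots> \<le> ?E n ^ p - ?c ^ p - K * (?E n - ?c)"
        unfolding K_def by (rule power_tangent_gap) (use s p excess_nonneg in auto)
      finally have "?E n - ?c \<le> (?E n ^ p - ?c ^ p) / K"
        using K by (simp add: pos_le_divide_eq mult.commute)
      then show "?E n \<le> ?c + (?E n ^ p - ?c ^ p) / K" by simp
    qed
    also have "(\<Sum>n\<in>{1..N}. ?c + (?E n ^ p - ?c ^ p) / K + ?q)
        = real N * ?c + ((\<Sum>n\<in>{1..N}. ?E n ^ p) - real N * ?c ^ p) / K + real N * ?q"
      by (simp add: sum.distrib sum_subtractf flip: sum_divide_distrib)
    also have "\<dots> / real N = ?c + ((\<Sum>n\<in>{1..N}. ?E n ^ p) / real N - ?c ^ p) / K + ?q"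
      using N0 K by (simp add: add_divide_distrib diff_divide_distrib)
    also have "\<dots> \<le> ?c + (R N - ?c ^ p) / K + ?q"
      using sum_excess_power_le_corr[OF elim(1), of p \<beta> x s] K unfolding R_def
      by (intro add_mono divide_right_mono) auto
    also have "?q = real p * real N powr (\<beta> - 1)"
      using N0 by (simp add: powr_diff)
    finally show ?case using elim by (simp add: U_def divide_right_mono)
  qed
qed (use \<beta> s in auto)

lemma poissonian_imp_pair_corr:
  assumes "poissonian_correlations (Suc p) \<beta> x" "p \<ge> 2" "0 \<le> \<beta>" "\<beta> < 1"
    "s > 0" "\<beta> = 0 \<longrightarrow> s \<le> 1/2"
  shows "(\<lambda>N. pair_corr \<beta> x s N) \<longlonglongrightarrow> 2 * s"
  using assms by (intro pair_corr_tendsto poissonian_imp_near_pairs_bound) auto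

lemma real_div_powr_tendsto_0: "\<beta> < 1 \<Longrightarrow> (\<lambda>N. c / real N powr (1 - \<beta>)) \<longlonglongrightarrow> 0"
  using tendsto_mult_right_zero[OF tendsto_of_nat_powr_neg[of "- (1 - \<beta>)"], of c]
  by (simp add: divide_inverse flip: powr_minus)

text \<open>
  The first and the \<open>p\<close>-th moment of the normalised number of neighbours both tend to \<open>1\<close>, which is
  the equality case of Jensen's inequality.
\<close>

lemma neighbours_concentrate:
  assumes pc: "poissonian_correlations (Suc p) \<beta> x" and p: "p \<ge> 2" and \<beta>: "0 \<le> \<beta>" "\<beta> < 1"
  shows "(\<lambda>N. (\<Sum>n\<in>{1..N}. \<bar>real (card (neighbours \<beta> x (- (1/2)) (1/2) N n)) / real N powr (1 - \<beta>) - 1\<bar> ^ p) / real N)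
    \<longlonglongrightarrow> 0"
proof -
  define R where "R = corr (Suc p) \<beta> x (rectangle p (\<lambda>_. - (1/2)) (\<lambda>_. 1/2))"
  define q where "q N = real p / real N powr (1 - \<beta>)" for N
  \<comment> \<open>The averaged tangent inequality at \<open>2 * s = 1\<close>. The factor
    \<open>2 ^ p\<close> and the last term come from splitting off the difference, at most
    \<open>q N\<close>, between \<open>excess\<close> and the neighbour count.\<close>
  define U where "U N = 2 ^ p * ((R N - 1 - real p * (pair_corr \<beta> x (1/2) N - q N - 1)) + q N ^ p)" for N
  have q: "q \<longlonglongrightarrow> 0" unfolding q_def using \<beta>(2) by (rule real_div_powr_tendsto_0)
  have R: "R \<longlonglongrightarrow> 1" unfolding R_def using poissonian_corr_cube[OF pc, of "1/2"] by simp
  have "(\<lambda>N. pair_corr \<beta> x (1/2) N) \<longlonglongrightarrow> 1"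
    using poissonian_imp_pair_corr[OF pc p \<beta>, of "1/2"] by simp
  then have "U \<longlonglongrightarrow> 2 ^ p * ((1 - 1 - real p * (1 - 0 - 1)) + 0 ^ p)"
    unfolding U_def using q R by (intro tendsto_intros)
  then have U: "U \<longlonglongrightarrow> 0" using p by (simp add: power_0_left)
  show ?thesis
  proof (rule tendsto_sandwich[OF _ _ tendsto_const U])
    show "\<forall>\<^sub>F N in sequentially.
        (\<Sum>n\<in>{1..N}. \<bar>real (card (neighbours \<beta> x (- (1/2)) (1/2) N n)) / real N powr (1 - \<beta>) - 1\<bar> ^ p) / real N \<le> U N"
      using eventually_ge_at_top[of 1]
    proof eventually_elim
      case (elim N)
      let ?E = "\<lambda>n. excess p \<beta> x (1/2) N n"
      let ?G = "\<lambda>n. real (card (neighbours \<beta> x (- (1/2)) (1/2) N n)) / real N powr (1 - \<beta>)"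
      have N0: "real N > 0" using elim by simp
      have q0: "q N \<ge> 0" by (simp add: q_def)
      have EG: "?E n \<le> ?G n" "?G n \<le> ?E n + q N" for n
        unfolding q_def by (rule excess_le le_excess)+
      have "(\<Sum>n\<in>{1..N}. \<bar>?G n - 1\<bar> ^ p) \<le> (\<Sum>n\<in>{1..N}. 2 ^ p * ((?E n ^ p - 1 - real p * (?G n - q N - 1)) + q N ^ p))"
      proof (rule sum_mono)
        fix n
        have "\<bar>?G n - 1\<bar> ^ p \<le> (\<bar>?E n - 1\<bar> + q N) ^ p"
          using EG[of n] q0 by (intro power_mono) linarith+
        also have "\<dots> \<le> 2 ^ p * (\<bar>?E n - 1\<bar> ^ p + q N ^ p)"
          using q0 by (intro power_add_le) auto
        also have "\<bar>?E n - 1\<bar> ^ p \<le> ?E n ^ p - 1 - real p * (?E n - 1)"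
          using power_tangent_gap[of "?E n" 1 p] p excess_nonneg by simp
        \<comment> \<open>The first moment enters with a negative sign, so the lower bound contained
          in the limit of \<open>pair_corr\<close> is essential.\<close>
        also have "\<dots> \<le> ?E n ^ p - 1 - real p * (?G n - q N - 1)"
        proof -
          have "real p * (?G n - q N - 1) \<le> real p * (?E n - 1)"
            using EG[of n] by (intro mult_left_mono) linarith+
          then show ?thesis by linarith
        qed
        finally show "\<bar>?G n - 1\<bar> ^ p \<le> 2 ^ p * ((?E n ^ p - 1 - real p * (?G n - q N - 1)) + q N ^ p)"
          by simp
      qed
      also have "\<dots> = 2 ^ p * (((\<Sum>n\<in>{1..N}. ?E n ^ p) - real N - real p * ((\<Sum>n\<in>{1..N}. ?G n) - real N * q N - real N)) + real N * q N ^ p)"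
        by (simp add: sum.distrib sum_subtractf flip: sum_distrib_left)
      finally have "(\<Sum>n\<in>{1..N}. \<bar>?G n - 1\<bar> ^ p) / real N \<le> \<dots> / real N"
        by (rule divide_right_mono) simp
      also have "\<dots> = 2 ^ p * (((\<Sum>n\<in>{1..N}. ?E n ^ p) / real N - 1 - real p * (pair_corr \<beta> x (1/2) N - q N - 1)) + q N ^ p)"
        unfolding pair_corr_eq_sum_neighbours[OF elim] using N0 by (simp add: field_simps)
      also have "\<dots> \<le> U N"
        unfolding U_def R_def using sum_excess_power_le_corr[OF elim, of p \<beta> x "1/2"]
        by (intro mult_left_mono add_right_mono diff_right_mono) auto
      finally show ?case .
    qed
  qed (auto intro!: always_eventually sum_nonneg divide_nonneg_nonneg)
qed

text \<open>A general rectangle need not fit into the cube of side \<open>1\<close>, so other radii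
  occur. The moment of \<open>excess\<close> is at most a convergent correlation, and
  \<open>q N\<close> tends to \<open>0\<close>.\<close>

lemma neighbours_moment_bounded:
  assumes pc: "poissonian_correlations (Suc p) \<beta> x" and p: "p \<ge> 2" and \<beta>: "\<beta> < 1"
    and s: "s > 0" "\<beta> = 0 \<longrightarrow> s \<le> 1/2"
  obtains K where "K > 0" "\<forall>\<^sub>F N in sequentially.
    (\<Sum>n\<in>{1..N}. (real (card (neighbours \<beta> x (- s) s N n)) / real N powr (1 - \<beta>)) ^ p) / real N \<le> K"
proof -
  define R where "R = corr (Suc p) \<beta> x (rectangle p (\<lambda>_. - s) (\<lambda>_. s))"
  define q where "q N = real p / real N powr (1 - \<beta>)" for N
  define U where "U N = 2 ^ p * (R N + q N ^ p)" for N
  have q: "q \<longlonglongrightarrow> 0" unfolding q_def using \<beta> by (rule real_div_powr_tendsto_0)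
  have R: "R \<longlonglongrightarrow> (2 * s) ^ p" unfolding R_def by (rule poissonian_corr_cube[OF pc s])
  have "U \<longlonglongrightarrow> 2 ^ p * ((2 * s) ^ p + 0 ^ p)"
    unfolding U_def using q R by (intro tendsto_intros)
  then have "\<forall>\<^sub>F N in sequentially. U N < 2 ^ p * ((2 * s) ^ p + 0 ^ p) + 1"
    by (rule order_tendstoD) simp
  with eventually_ge_at_top[of 1]
  have "\<forall>\<^sub>F N in sequentially.
    (\<Sum>n\<in>{1..N}. (real (card (neighbours \<beta> x (- s) s N n)) / real N powr (1 - \<beta>)) ^ p) / real N
      \<le> 2 ^ p * ((2 * s) ^ p + 0 ^ p) + 1"
  proof eventually_elim
    case (elim N)
    let ?E = "\<lambda>n. excess p \<beta> x s N n"
    have "(\<Sum>n\<in>{1..N}. (real (card (neighbours \<beta> x (- s) s N n)) / real N powr (1 - \<beta>)) ^ p)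
        \<le> (\<Sum>n\<in>{1..N}. (?E n + q N) ^ p)"
      unfolding q_def by (intro sum_mono power_mono le_excess) simp
    also have "\<dots> \<le> (\<Sum>n\<in>{1..N}. 2 ^ p * (?E n ^ p + q N ^ p))"
      by (intro sum_mono power_add_le excess_nonneg) (simp add: q_def)
    also have "\<dots> = 2 ^ p * ((\<Sum>n\<in>{1..N}. ?E n ^ p) + real N * q N ^ p)"
      by (simp add: sum.distrib flip: sum_distrib_left)
    finally have "(\<Sum>n\<in>{1..N}. (real (card (neighbours \<beta> x (- s) s N n)) / real N powr (1 - \<beta>)) ^ p) / real N \<le> \<dots> / real N"
      by (rule divide_right_mono) simp
    also have "\<dots> = 2 ^ p * ((\<Sum>n\<in>{1..N}. ?E n ^ p) / real N + q N ^ p)"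
      using elim by (simp add: field_simps)
    also have "\<dots> \<le> U N"
      unfolding U_def R_def using sum_excess_power_le_corr[OF elim(1), of p \<beta> x s]
      by (intro mult_left_mono add_right_mono) auto
    finally show ?case using elim by simp
  qed
  moreover have "2 ^ p * ((2 * s) ^ p + 0 ^ p) + 1 > (0::real)"
    using s by (intro add_nonneg_pos mult_nonneg_nonneg add_nonneg_nonneg) auto
  ultimately show ?thesis using that by blast
qed

text \<open>A Holder argument: the first factor tends to \<open>0\<close> in \<open>p\<close>-th
  mean and the second stays bounded. This controls the error of replacing the number of choices for
  the last index by its mean.\<close>

lemma neighbours_mixed_moment:
  assumes pc: "poissonian_correlations (Suc p) \<beta> x" and p: "p \<ge> 2" and \<beta>: "0 \<le> \<beta>" "\<beta> < 1"
    and s: "s > 0" "\<beta> = 0 \<longrightarrow> s \<le> 1/2"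
  shows "(\<lambda>N. (\<Sum>n\<in>{1..N}. \<bar>real (card (neighbours \<beta> x (- (1/2)) (1/2) N n)) / real N powr (1 - \<beta>) - 1\<bar>
      * (real (card (neighbours \<beta> x (- s) s N n)) / real N powr (1 - \<beta>)) ^ (p - 1)) / real N) \<longlonglongrightarrow> 0"
    (is "(\<lambda>N. (\<Sum>n\<in>{1..N}. ?D N n * ?Q N n ^ (p - 1)) / real N) \<longlonglongrightarrow> 0")
proof (rule tendstoI)
  fix e :: real assume e: "e > 0"
  obtain K where K: "K > 0" and evK: "\<forall>\<^sub>F N in sequentially. (\<Sum>n\<in>{1..N}. ?Q N n ^ p) / real N \<le> K"
    by (rule neighbours_moment_bounded[OF pc p \<beta>(2) s])
  \<comment> \<open>As \<open>\<eta> ^ p \<le> \<eta>\<close>, the \<open>Q\<close> part contributes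
    at most \<open>e / 2\<close>; for fixed \<open>\<eta>\<close> the \<open>D\<close> part tends to
    \<open>0\<close>.\<close>
  define \<eta> where "\<eta> = min 1 (e / (2 * K))"
  have \<eta>: "\<eta> > 0" "\<eta> \<le> 1" "\<eta> \<le> e / (2 * K)" using e K by (auto simp: \<eta>_def)
  have "\<eta> ^ p \<le> \<eta> ^ 1" using \<eta> p by (intro power_decreasing) auto
  then have "\<eta> ^ p * K \<le> e / (2 * K) * K" using \<eta>(3) K by (intro mult_right_mono) auto
  then have \<eta>p: "\<eta> ^ p * K \<le> e / 2" using K by simp
  define Z where "Z = (\<eta> ^ (p - 1)) ^ p"
  have Z: "Z > 0" using \<eta> by (simp add: Z_def)
  have "\<forall>\<^sub>F N in sequentially. (\<Sum>n\<in>{1..N}. ?D N n ^ p) / real N < e / 2 * Z"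
    using neighbours_concentrate[OF pc p \<beta>] by (rule order_tendstoD) (use e Z in simp)
  with evK show "\<forall>\<^sub>F N in sequentially. dist ((\<Sum>n\<in>{1..N}. ?D N n * ?Q N n ^ (p - 1)) / real N) 0 < e"
  proof eventually_elim
    case (elim N)
    have "(\<Sum>n\<in>{1..N}. ?D N n * ?Q N n ^ (p - 1)) \<le> (\<Sum>n\<in>{1..N}. ?D N n ^ p / Z + \<eta> ^ p * ?Q N n ^ p)"
      unfolding Z_def using \<eta> p by (intro sum_mono mult_power_le_scaled) auto
    also have "\<dots> = (\<Sum>n\<in>{1..N}. ?D N n ^ p) / Z + \<eta> ^ p * (\<Sum>n\<in>{1..N}. ?Q N n ^ p)"
      by (simp add: sum.distrib sum_divide_distrib sum_distrib_left)
    finally have "(\<Sum>n\<in>{1..N}. ?D N n * ?Q N n ^ (p - 1)) / real N \<le> \<dots> / real N"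
      by (rule divide_right_mono) simp
    also have "\<dots> = (\<Sum>n\<in>{1..N}. ?D N n ^ p) / real N / Z + \<eta> ^ p * ((\<Sum>n\<in>{1..N}. ?Q N n ^ p) / real N)"
      by (simp add: add_divide_distrib mult.commute)
    also have "\<dots> < e / 2 + \<eta> ^ p * K"
    proof (rule add_less_le_mono)
      show "(\<Sum>n\<in>{1..N}. ?D N n ^ p) / real N / Z < e / 2"
        using elim(2) by (subst pos_divide_less_eq[OF Z])
      show "\<eta> ^ p * ((\<Sum>n\<in>{1..N}. ?Q N n ^ p) / real N) \<le> \<eta> ^ p * K"
        using elim(1) \<eta> by (intro mult_left_mono) auto
    qed
    also have "\<dots> \<le> e" using \<eta>p by simp
    finally have "(\<Sum>n\<in>{1..N}. ?D N n * ?Q N n ^ (p - 1)) / real N < e" .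
    moreover have "(\<Sum>n\<in>{1..N}. ?D N n * ?Q N n ^ (p - 1)) / real N \<ge> 0"
      by (intro divide_nonneg_nonneg sum_nonneg mult_nonneg_nonneg zero_le_power) auto
    ultimately show ?case by (simp add: dist_real_def)
  qed
qed

section \<open>Summing out the last coordinate\<close>

lemma rectangle_subset_bounds:
  assumes "rectangle d a b \<subseteq> rectangle d a' b'" "\<forall>j\<in>{1..d}. a j \<le> b j" "j \<in> {1..d}"
  shows "a' j \<le> a j" "b j \<le> b' j"
proof -
  have "restrict a {1..d} \<in> rectangle d a b" "restrict b {1..d} \<in> rectangle d a b"
    using assms(2) by (auto simp: rectangle_def)
  then have "restrict a {1..d} \<in> rectangle d a' b'" "restrict b {1..d} \<in> rectangle d a' b'"
    using assms(1) by auto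
  then show "a' j \<le> a j" "b j \<le> b' j" using assms(3) by (auto simp: rectangle_def PiE_iff)
qed

text \<open>Appending the side \<open>{-(1/2)..1/2}\<close> preserves the volume and is allowed at
  \<open>\<beta> = 0\<close>. In the mean a tuple of order \<open>p\<close> then extends in about
  \<open>real N powr (1 - \<beta>)\<close> ways, with an error controlled by
  \<open>neighbours_mixed_moment\<close>.\<close>

lemma poissonian_correlations_pred:
  assumes pc: "poissonian_correlations (Suc p) \<beta> x" and p: "p \<ge> 2" and \<beta>: "0 \<le> \<beta>" "\<beta> < 1"
  shows "poissonian_correlations p \<beta> x"
  unfolding poissonian_correlations_def
proof (intro allI impI)
  fix a b :: "nat \<Rightarrow> real"
  assume ab: "\<forall>j\<in>{1..p-1}. a j \<le> b j"
    and sub: "\<beta> = 0 \<longrightarrow> rectangle (p-1) a b \<subseteq> rectangle (p-1) (\<lambda>_. -(1/2)) (\<lambda>_. 1/2)"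
  \<comment> \<open>A cube around the rectangle bounds tuple counts by powers of neighbour counts;
    at \<open>\<beta> = 0\<close> its radius must not exceed \<open>1/2\<close>.\<close>
  obtain s where s: "s > 0" "\<beta> = 0 \<longrightarrow> s \<le> 1/2" and sab: "\<And>j. j \<in> {1..p-1} \<Longrightarrow> - s \<le> a j \<and> b j \<le> s"
  proof (cases "\<beta> = 0")
    case True
    then have "- (1/2) \<le> a j \<and> b j \<le> 1/2" if "j \<in> {1..p-1}" for j
      using rectangle_subset_bounds[OF _ ab that, of "\<lambda>_. -(1/2)" "\<lambda>_. 1/2"] sub by auto
    then show ?thesis by (intro that[of "1/2"]) auto
  next
    case False
    let ?s = "1 + (\<Sum>j\<in>{1..p-1}. \<bar>a j\<bar> + \<bar>b j\<bar>)"
    have "- ?s \<le> a j \<and> b j \<le> ?s" if "j \<in> {1..p-1}" for j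
    proof -
      have "\<bar>a j\<bar> + \<bar>b j\<bar> \<le> (\<Sum>j\<in>{1..p-1}. \<bar>a j\<bar> + \<bar>b j\<bar>)"
        using that by (intro member_le_sum) auto
      then show ?thesis by linarith
    qed
    moreover have "?s > 0" by (intro add_pos_nonneg sum_nonneg) auto
    ultimately show ?thesis using False by (intro that[of ?s]) auto
  qed
  define a' where "a' = a(p := -(1/2))"
  define b' where "b' = b(p := 1/2)"
  have P: "{1..p} = insert p {1..p-1}" "p \<notin> {1..p-1}" using p by auto
  have ab': "\<forall>j\<in>{1..p}. a' j \<le> b' j" using ab unfolding P(1) by (auto simp: a'_def b'_def)
  define lam where "lam = measure (lebesgue_space (p-1)) (rectangle (p-1) a b)"
  have "measure (lebesgue_space p) (rectangle p a' b') = (\<Prod>j\<in>{1..p}. b' j - a' j)"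
    using ab' by (intro measure_rectangle) auto
  also have "\<dots> = (\<Prod>j\<in>{1..p-1}. b' j - a' j)"
    unfolding P(1) using P(2) by (subst prod.insert) (auto simp: a'_def b'_def)
  also have "\<dots> = (\<Prod>j\<in>{1..p-1}. b j - a j)"
    using P(2) by (intro prod.cong) (auto simp: a'_def b'_def)
  also have "\<dots> = lam" unfolding lam_def using ab by (intro measure_rectangle[symmetric]) auto
  finally have lam: "measure (lebesgue_space p) (rectangle p a' b') = lam" .
  have "rectangle p a' b' \<subseteq> rectangle p (\<lambda>_. -(1/2)) (\<lambda>_. 1/2)" if "\<beta> = 0"
    unfolding rectangle_def
  proof (intro PiE_mono)
    fix j assume "j \<in> {1..p}"
    then have "j = p \<or> j \<in> {1..p-1}" using P by auto
    then show "{a' j..b' j} \<subseteq> {-(1/2)..1/2}"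
      using sab[of j] s(2) that by (auto simp: a'_def b'_def)
  qed
  then have "corr (Suc p) \<beta> x (rectangle p a' b') \<longlonglongrightarrow> measure (lebesgue_space p) (rectangle p a' b')"
    using pc ab' unfolding poissonian_correlations_def diff_Suc_1 by blast
  then have R: "corr (Suc p) \<beta> x (rectangle p a' b') \<longlonglongrightarrow> lam" by (simp only: lam)
  define R where "R = corr (Suc p) \<beta> x (rectangle p a' b')"
  define G where "G N n = real (card (neighbours \<beta> x (- (1/2)) (1/2) N n)) / real N powr (1 - \<beta>)" for N n
  define Q where "Q N n = real (card (neighbours \<beta> x (- s) s N n)) / real N powr (1 - \<beta>)" for N n
  define err where "err N = (\<Sum>n\<in>{1..N}. \<bar>G N n - 1\<bar> * Q N n ^ (p - 1)) / real N" for N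
  define q where "q N = real p / real N powr (1 - \<beta>)" for N
  have err: "err \<longlonglongrightarrow> 0"
    unfolding err_def G_def Q_def by (rule neighbours_mixed_moment[OF pc p \<beta> s])
  have q: "q \<longlonglongrightarrow> 0" unfolding q_def using \<beta>(2) by (rule real_div_powr_tendsto_0)
  \<comment> \<open>\<open>err\<close> bounds the total deviation of \<open>G\<close> from
    \<open>1\<close> over the tuples; \<open>1 - q N\<close> allows for the at most \<open>p\<close>
    neighbours already used.\<close>
  have bounds: "\<forall>\<^sub>F N in sequentially. R N - err N \<le> corr p \<beta> x (rectangle (p-1) a b) N
      \<and> corr p \<beta> x (rectangle (p-1) a b) N \<le> (R N + err N) / (1 - q N)"
  proof -
    have "\<forall>\<^sub>F N in sequentially. q N < 1" using q by (rule order_tendstoD) simp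
    with eventually_ge_at_top[of 1] show ?thesis
    proof eventually_elim
      case (elim N)
      let ?\<Theta> = "real N powr (1 - \<beta>)"
      let ?T = "tuples p \<beta> x a b N"
      let ?Z = "real N * ?\<Theta> ^ (p - 1)"
      have N0: "real N > 0" and \<Theta>: "?\<Theta> > 0" using elim by auto
      have Z: "?Z > 0" using N0 by simp
      have T: "tuples p \<beta> x a' b' N = ?T"
        using P(2) unfolding tuples_def a'_def b'_def by (intro Collect_cong conj_cong refl ball_cong) auto
      have A: "corr p \<beta> x (rectangle (p-1) a b) N = real (card ?T) / ?Z"
        using corr_rectangle[of p] powr_corr_exponent[OF elim(1), of p \<beta>] p by simp
      have Z': "real N * ?\<Theta> ^ p = ?\<Theta> * ?Z" using p by (cases p) auto
      have "real (card (tuples (Suc p) \<beta> x a' b' N))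
          = (\<Sum>i\<in>?T. real (card (neighbours \<beta> x (- (1/2)) (1/2) N (i 1) - i ` {1..p})))"
        using sum_tuples_Suc[of p "\<lambda>_. 1" \<beta> x a' b' N] p unfolding T by (simp add: a'_def b'_def)
      moreover have "R N = real (card (tuples (Suc p) \<beta> x a' b' N)) / (?\<Theta> * ?Z)"
        using corr_rectangle[of "Suc p" \<beta> x a' b' N] powr_corr_exponent[OF elim(1), of "Suc p" \<beta>]
        unfolding R_def by (simp add: Z')
      ultimately have Req: "R N = (\<Sum>i\<in>?T. real (card (neighbours \<beta> x (- (1/2)) (1/2) N (i 1) - i ` {1..p})) / ?\<Theta>) / ?Z"
        by (simp flip: sum_divide_distrib)
      \<comment> \<open>The deviation depends on the first index alone, so it can serve as the
        weight \<open>h\<close>.\<close>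
      have "(\<Sum>i\<in>?T. \<bar>G N (i 1) - 1\<bar>) \<le> (\<Sum>n\<in>{1..N}. \<bar>G N n - 1\<bar> * real (card (neighbours \<beta> x (- s) s N n)) ^ (p - 1))"
        by (rule sum_tuples_upper) (use p sab in auto)
      also have "\<dots> = err N * ?Z"
        unfolding err_def Q_def using N0 by (simp add: power_divide sum_divide_distrib sum_distrib_right)
      finally have errT: "(\<Sum>i\<in>?T. \<bar>G N (i 1) - 1\<bar>) / ?Z \<le> err N"
        using Z by (simp add: pos_divide_le_eq)
      have up: "R N \<le> real (card ?T) / ?Z + err N"
      proof -
        have "(\<Sum>i\<in>?T. real (card (neighbours \<beta> x (- (1/2)) (1/2) N (i 1) - i ` {1..p})) / ?\<Theta>)
            \<le> (\<Sum>i\<in>?T. 1 + \<bar>G N (i 1) - 1\<bar>)"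
        proof (rule sum_mono)
          fix i
          have "card (neighbours \<beta> x (- (1/2)) (1/2) N (i 1) - i ` {1..p}) \<le> card (neighbours \<beta> x (- (1/2)) (1/2) N (i 1))"
            by (rule card_mono) auto
          then have "real (card (neighbours \<beta> x (- (1/2)) (1/2) N (i 1) - i ` {1..p})) / ?\<Theta> \<le> G N (i 1)"
            unfolding G_def by (intro divide_right_mono) auto
          then show "real (card (neighbours \<beta> x (- (1/2)) (1/2) N (i 1) - i ` {1..p})) / ?\<Theta> \<le> 1 + \<bar>G N (i 1) - 1\<bar>"
            by linarith
        qed
        also have "\<dots> = real (card ?T) + (\<Sum>i\<in>?T. \<bar>G N (i 1) - 1\<bar>)" by (simp add: sum.distrib)
        finally have "R N \<le> \<dots> / ?Z" unfolding Req using Z by (intro divide_right_mono) auto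
        then show ?thesis using errT by (simp add: add_divide_distrib)
      qed
      have lo: "real (card ?T) / ?Z * (1 - q N) - err N \<le> R N"
      proof -
        have "real (card ?T) * (1 - q N) - (\<Sum>i\<in>?T. \<bar>G N (i 1) - 1\<bar>) = (\<Sum>i\<in>?T. (1 - q N) - \<bar>G N (i 1) - 1\<bar>)"
          by (simp add: sum_subtractf)
        also have "\<dots> \<le> (\<Sum>i\<in>?T. real (card (neighbours \<beta> x (- (1/2)) (1/2) N (i 1) - i ` {1..p})) / ?\<Theta>)"
        proof (rule sum_mono)
          fix i
          have "real (card (neighbours \<beta> x (- (1/2)) (1/2) N (i 1))) - real p
              \<le> real (card (neighbours \<beta> x (- (1/2)) (1/2) N (i 1) - i ` {1..p}))"
            using card_Diff_image_ge[of "neighbours \<beta> x (- (1/2)) (1/2) N (i 1)" p p i] by simp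
          then have "G N (i 1) - q N \<le> real (card (neighbours \<beta> x (- (1/2)) (1/2) N (i 1) - i ` {1..p})) / ?\<Theta>"
            unfolding G_def q_def diff_divide_distrib[symmetric] by (intro divide_right_mono) auto
          then show "(1 - q N) - \<bar>G N (i 1) - 1\<bar> \<le> real (card (neighbours \<beta> x (- (1/2)) (1/2) N (i 1) - i ` {1..p})) / ?\<Theta>"
            by linarith
        qed
        finally have "(real (card ?T) * (1 - q N) - (\<Sum>i\<in>?T. \<bar>G N (i 1) - 1\<bar>)) / ?Z \<le> R N"
          unfolding Req using Z by (intro divide_right_mono) auto
        then show ?thesis using errT by (simp add: diff_divide_distrib)
      qed
      have one_q: "0 < 1 - q N" using elim(2) by simp
      have "real (card ?T) / ?Z \<le> (R N + err N) / (1 - q N)"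
        using lo one_q by (simp only: pos_le_divide_eq)
      moreover have "R N - err N \<le> real (card ?T) / ?Z" using up by linarith
      ultimately show ?case unfolding A by blast
    qed
  qed
  have lower: "(\<lambda>N. R N - err N) \<longlonglongrightarrow> lam"
    using tendsto_diff[OF R err] by (simp add: R_def)
  have "(\<lambda>N. (R N + err N) / (1 - q N)) \<longlonglongrightarrow> (lam + 0) / (1 - 0)"
    using R err q unfolding R_def by (intro tendsto_intros) auto
  then have upper: "(\<lambda>N. (R N + err N) / (1 - q N)) \<longlonglongrightarrow> lam" by simp
  show "(\<lambda>N. corr p \<beta> x (rectangle (p-1) a b) N)
      \<longlonglongrightarrow> measure (lebesgue_space (p-1)) (rectangle (p-1) a b)"
    unfolding lam_def[symmetric]
    by (rule tendsto_sandwich[OF bounds[unfolded eventually_conj_iff, THEN conjunct1]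
          bounds[unfolded eventually_conj_iff, THEN conjunct2] lower upper])
qed

theorem theorem8:
  fixes k :: nat and \<beta> :: real and x :: "nat \<Rightarrow> real"
  assumes "k > 2" and "0 \<le> \<beta>" and "\<beta> < 1"
    and "\<And>n. n \<ge> 1 \<Longrightarrow> x n \<in> {0..1}"
    and "poissonian_correlations k \<beta> x"
  shows "poissonian_correlations (k - 1) \<beta> x
    \<and> (\<forall>\<alpha>. 0 \<le> \<alpha> \<and> \<alpha> \<le> \<beta> \<longrightarrow> PPC \<alpha> x)
    \<and> uniformly_distributed x"
proof -
  obtain p where p: "k = Suc p" "p \<ge> 2" using assms(1) by (cases k) auto
  have pc: "poissonian_correlations (Suc p) \<beta> x" using assms(5) p by simp
  have "PPC \<beta> x"
    unfolding PPC_def using poissonian_imp_pair_corr[OF pc p(2) assms(2,3)] by blast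
  then have ppc: "PPC \<alpha> x" if "0 \<le> \<alpha>" "\<alpha> \<le> \<beta>" for \<alpha>
    using PPC_coarser assms(3) that by blast
  have "uniformly_distributed x"
    using PPC_0_imp_uniformly_distributed[OF ppc[of 0]] assms(2,4) by simp
  then show ?thesis
    using poissonian_correlations_pred[OF pc p(2) assms(2,3)] ppc p(1) by simp
qed

end
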